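(* The following decision problem is $\Pi^1_1$-complete: given an equational bitstream specification $E$ over a bitstream signature $\Sigma$ and two terms $s,t$ of sort $S$ over $\Sigma$, decide whether $s$ and $t$ are equal in all models of $E$, i.e. whether every stream model $\mathcal{A}$ of $E$ satisfies $[\![s]\!]^{\mathcal{A}}_\alpha=[\![t]\!]^{\mathcal{A}}_\alpha$ for every variable assignment $\alpha$.
   Context: Sorts are $B$ (bits) and $S$ (bitstreams). A bitstream signature $\Sigma$ is a set of function symbols, each with a type $f :: s_1\times\cdots\times s_n\to s$ with $s_i,s\in\{B,S\}$, containing the constants $0,1::B$ and the stream constructor $:\,::B\times S\to S$ (written infix). Terms are built from sorted variables and symbols respecting sorts. An equational bitstream specification over $\Sigma$ is a finite set of equations $\ell=r$ between terms of the same sort. A stream algebra $\mathcal{A}=\langle A,[\![\cdot]\!]\rangle$ consists of $A_B=\{0,1\}$, a nonempty set $A_S\subseteq\{0,1\}^{\mathbb N}$, and for each $f::s_1\times\cdots\times s_n\to s$ in $\Sigma$ a function $[\![f]\!]:A_{s_1}\times\cdots\times A_{s_n}\to A_s$, such that $[\![:]\!](x,\sigma)=x:\sigma$ (prepending the bit $x$ to the stream $\sigma$), $[\![0]\!]=0$ and $[\![1]\!]=1$. Terms are interpreted under sort-respecting variable assignments $\alpha:\mathcal X\to A$ in the usual compositional way. $\mathcal A$ is a (stream) model of $E$ if $[\![\ell]\!]_\alpha=[\![r]\!]_\alpha$ for every $\ell=r$ in $E$ and every assignment $\alpha$. Instances are coded as natural numbers by a standard Gödel numbering. A problem $P$ (set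 of codes of instances, with the well-formed instances as promise) is $\mathcal C$-hard if every set in the class $\mathcal C$ is many-one reducible to it by a partial recursive function defined on all relevant inputs and mapping them to well-formed instances; it is $\mathcal C$-complete if it is $\mathcal C$-hard and many-one reducible to some set in $\mathcal C$. $\Pi^1_1$, $\Sigma^1_1$, etc. are the classes of the analytical hierarchy. *)

theory Defs
  imports "HOL-Library.Nat_Bijection"
begin

section \<open>Bitstream signatures, terms and stream models\<close>

datatype srt = Bit | Stream

text \<open>
  A function symbol carries its type, so a signature is just a set of symbols.  The names of the
  symbols other than \<open>0\<close>, \<open>1\<close> and the stream constructor are natural numbers.
\<close>

datatype sym = Zero | One | SCons | Fn nat "srt list" srt

primrec arg_sorts :: "sym \<Rightarrow> srt list" where
  "arg_sorts Zero = []"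
| "arg_sorts One = []"
| "arg_sorts SCons = [Bit, Stream]"
| "arg_sorts (Fn f ss s) = ss"

primrec res_sort :: "sym \<Rightarrow> srt" where
  "res_sort Zero = Bit"
| "res_sort One = Bit"
| "res_sort SCons = Stream"
| "res_sort (Fn f ss s) = s"

definition bitstream_signature :: "sym set \<Rightarrow> bool" where
  "bitstream_signature \<Sigma> \<longleftrightarrow> {Zero, One, SCons} \<subseteq> \<Sigma>"

datatype trm = Var srt nat | App sym "trm list"

inductive has_sort :: "sym set \<Rightarrow> trm \<Rightarrow> srt \<Rightarrow> bool" for \<Sigma> where
  has_sort_Var: "has_sort \<Sigma> (Var s x) s"
| has_sort_App: "f \<in> \<Sigma> \<Longrightarrow> list_all2 (has_sort \<Sigma>) ts (arg_sorts f)
    \<Longrightarrow> has_sort \<Sigma> (App f ts) (res_sort f)"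

type_synonym eqn = "trm \<times> trm"

definition equational_spec :: "sym set \<Rightarrow> eqn set \<Rightarrow> bool" where
  "equational_spec \<Sigma> E \<longleftrightarrow>
     finite E \<and> (\<forall>(l, r)\<in>E. \<exists>s. has_sort \<Sigma> l s \<and> has_sort \<Sigma> r s)"

text \<open>
  Bits are Booleans, \<^term>\<open>False\<close> being the bit \<open>0\<close>; bitstreams are functions from \<^typ>\<open>nat\<close> to
  \<^typ>\<open>bool\<close>.
\<close>

datatype val = VBit bool | VStream "nat \<Rightarrow> bool"

primrec carrier :: "(nat \<Rightarrow> bool) set \<Rightarrow> srt \<Rightarrow> val set" where
  "carrier D Bit = range VBit"
| "carrier D Stream = VStream ` D"

text \<open>
  A stream algebra is given by its set of streams \<open>D\<close> and the interpretation \<open>I\<close> of the symbols.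
  The values of \<open>I f\<close> on argument lists that do not fit the type of \<open>f\<close> are never used.
\<close>

definition stream_algebra ::
  "sym set \<Rightarrow> (nat \<Rightarrow> bool) set \<Rightarrow> (sym \<Rightarrow> val list \<Rightarrow> val) \<Rightarrow> bool" where
  "stream_algebra \<Sigma> D I \<longleftrightarrow>
     D \<noteq> {} \<and>
     (\<forall>f\<in>\<Sigma>. \<forall>vs. list_all2 (\<lambda>v s. v \<in> carrier D s) vs (arg_sorts f)
        \<longrightarrow> I f vs \<in> carrier D (res_sort f)) \<and>
     I Zero [] = VBit False \<and>
     I One [] = VBit True \<and>
     (\<forall>x. \<forall>\<sigma>\<in>D. I SCons [VBit x, VStream \<sigma>] = VStream (case_nat x \<sigma>))"

definition assignment :: "(nat \<Rightarrow> bool) set \<Rightarrow> (srt \<Rightarrow> nat \<Rightarrow> val) \<Rightarrow> bool" where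
  "assignment D \<alpha> \<longleftrightarrow> (\<forall>s x. \<alpha> s x \<in> carrier D s)"

primrec eval :: "(sym \<Rightarrow> val list \<Rightarrow> val) \<Rightarrow> (srt \<Rightarrow> nat \<Rightarrow> val) \<Rightarrow> trm \<Rightarrow> val" where
  "eval I \<alpha> (Var s x) = \<alpha> s x"
| "eval I \<alpha> (App f ts) = I f (map (eval I \<alpha>) ts)"

definition satisfies ::
  "(nat \<Rightarrow> bool) set \<Rightarrow> (sym \<Rightarrow> val list \<Rightarrow> val) \<Rightarrow> eqn \<Rightarrow> bool" where
  "satisfies D I e \<longleftrightarrow>
     (\<forall>\<alpha>. assignment D \<alpha> \<longrightarrow> eval I \<alpha> (fst e) = eval I \<alpha> (snd e))"

definition stream_model ::
  "sym set \<Rightarrow> eqn set \<Rightarrow> (nat \<Rightarrow> bool) set \<Rightarrow> (sym \<Rightarrow> val list \<Rightarrow> val) \<Rightarrow> bool" where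
  "stream_model \<Sigma> E D I \<longleftrightarrow> stream_algebra \<Sigma> D I \<and> (\<forall>e\<in>E. satisfies D I e)"

definition equal_in_all_models :: "sym set \<Rightarrow> eqn set \<Rightarrow> trm \<Rightarrow> trm \<Rightarrow> bool" where
  "equal_in_all_models \<Sigma> E s t \<longleftrightarrow>
     (\<forall>D I. stream_model \<Sigma> E D I \<longrightarrow> satisfies D I (s, t))"


section \<open>Partial recursive functions\<close>

text \<open>
  \<open>partial_recursive_n n f\<close>: the restriction of \<open>f\<close> to lists of length \<open>n\<close> is an \<open>n\<close>-ary partial
  recursive function, \<^term>\<open>None\<close> meaning undefined.  Values on lists of other lengths are junk.
\<close>

inductive partial_recursive_n :: "nat \<Rightarrow> (nat list \<Rightarrow> nat option) \<Rightarrow> bool" where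
  pr_zero: "partial_recursive_n n (\<lambda>xs. Some 0)"
| pr_suc: "partial_recursive_n 1 (\<lambda>xs. Some (Suc (hd xs)))"
| pr_proj: "i < n \<Longrightarrow> partial_recursive_n n (\<lambda>xs. Some (xs ! i))"
| pr_comp: "partial_recursive_n (length gs) f \<Longrightarrow> \<forall>g\<in>set gs. partial_recursive_n n g
    \<Longrightarrow> partial_recursive_n n (\<lambda>xs. Option.bind (those (map (\<lambda>g. g xs) gs)) f)"
| pr_rec: "partial_recursive_n n f \<Longrightarrow> partial_recursive_n (Suc (Suc n)) g
    \<Longrightarrow> partial_recursive_n (Suc n)
          (\<lambda>xs. rec_nat (f (tl xs))
                  (\<lambda>k r. Option.bind r (\<lambda>y. g (k # y # tl xs))) (hd xs))"
| pr_mu: "partial_recursive_n (Suc n) f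
    \<Longrightarrow> partial_recursive_n n
          (\<lambda>xs. if \<exists>k. f (k # xs) = Some 0 \<and> (\<forall>j<k. f (j # xs) \<noteq> None)
                then Some (LEAST k. f (k # xs) = Some 0) else None)"

definition partial_recursive :: "(nat \<Rightarrow> nat option) \<Rightarrow> bool" where
  "partial_recursive f \<longleftrightarrow> (\<exists>g. partial_recursive_n 1 g \<and> (\<forall>x. f x = g [x]))"


section \<open>Decision problems, hardness and completeness\<close>

text \<open>
  A problem is the set of codes of its well-formed instances (the promise) together with the set
  of codes of its yes-instances.  A set \<open>A\<close> of numbers is the problem \<open>(UNIV, A)\<close>.
\<close>

type_synonym problem = "nat set \<times> nat set"

definition many_one_reducible :: "problem \<Rightarrow> problem \<Rightarrow> bool" where
  "many_one_reducible P Q \<longleftrightarrow>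
     (\<exists>f. partial_recursive f \<and>
        (\<forall>n\<in>fst P. \<exists>m. f n = Some m \<and> m \<in> fst Q \<and> (n \<in> snd P \<longleftrightarrow> m \<in> snd Q)))"

definition hard_for :: "nat set set \<Rightarrow> problem \<Rightarrow> bool" where
  "hard_for \<C> P \<longleftrightarrow> (\<forall>A\<in>\<C>. many_one_reducible (UNIV, A) P)"

definition complete_for :: "nat set set \<Rightarrow> problem \<Rightarrow> bool" where
  "complete_for \<C> P \<longleftrightarrow> hard_for \<C> P \<and> (\<exists>A\<in>\<C>. many_one_reducible P (UNIV, A))"


section \<open>The analytical hierarchy\<close>

text \<open>
  Formulas of second-order arithmetic.  Second-order variables range over functions from numbers
  to numbers; \<open>NApp g a\<close> applies the function variable \<open>g\<close> to the term \<open>a\<close>.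
\<close>

datatype nterm =
    NVar nat
  | NZero
  | NSuc nterm
  | NAdd nterm nterm
  | NMul nterm nterm
  | NApp nat nterm

datatype form =
    Eq nterm nterm
  | Neg form
  | Conj form form
  | AllN nat form
  | ExN nat form
  | AllF nat form
  | ExF nat form

primrec nval :: "(nat \<Rightarrow> nat) \<Rightarrow> (nat \<Rightarrow> nat \<Rightarrow> nat) \<Rightarrow> nterm \<Rightarrow> nat" where
  "nval v w (NVar x) = v x"
| "nval v w NZero = 0"
| "nval v w (NSuc a) = Suc (nval v w a)"
| "nval v w (NAdd a b) = nval v w a + nval v w b"
| "nval v w (NMul a b) = nval v w a * nval v w b"
| "nval v w (NApp g a) = w g (nval v w a)"

primrec holds :: "(nat \<Rightarrow> nat) \<Rightarrow> (nat \<Rightarrow> nat \<Rightarrow> nat) \<Rightarrow> form \<Rightarrow> bool" where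
  "holds v w (Eq a b) \<longleftrightarrow> nval v w a = nval v w b"
| "holds v w (Neg \<phi>) \<longleftrightarrow> \<not> holds v w \<phi>"
| "holds v w (Conj \<phi> \<psi>) \<longleftrightarrow> holds v w \<phi> \<and> holds v w \<psi>"
| "holds v w (AllN x \<phi>) \<longleftrightarrow> (\<forall>n. holds (v(x := n)) w \<phi>)"
| "holds v w (ExN x \<phi>) \<longleftrightarrow> (\<exists>n. holds (v(x := n)) w \<phi>)"
| "holds v w (AllF g \<phi>) \<longleftrightarrow> (\<forall>h. holds v (w(g := h)) \<phi>)"
| "holds v w (ExF g \<phi>) \<longleftrightarrow> (\<exists>h. holds v (w(g := h)) \<phi>)"

primrec arithmetical :: "form \<Rightarrow> bool" where
  "arithmetical (Eq a b) \<longleftrightarrow> True"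
| "arithmetical (Neg \<phi>) \<longleftrightarrow> arithmetical \<phi>"
| "arithmetical (Conj \<phi> \<psi>) \<longleftrightarrow> arithmetical \<phi> \<and> arithmetical \<psi>"
| "arithmetical (AllN x \<phi>) \<longleftrightarrow> arithmetical \<phi>"
| "arithmetical (ExN x \<phi>) \<longleftrightarrow> arithmetical \<phi>"
| "arithmetical (AllF g \<phi>) \<longleftrightarrow> False"
| "arithmetical (ExF g \<phi>) \<longleftrightarrow> False"

inductive Sigma1_form :: "nat \<Rightarrow> form \<Rightarrow> bool" and Pi1_form :: "nat \<Rightarrow> form \<Rightarrow> bool" where
  Sigma1_arith: "arithmetical \<phi> \<Longrightarrow> Sigma1_form 0 \<phi>"
| Pi1_arith: "arithmetical \<phi> \<Longrightarrow> Pi1_form 0 \<phi>"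
| Sigma1_Suc: "Pi1_form n \<phi> \<Longrightarrow> Sigma1_form (Suc n) \<phi>"
| Pi1_Suc: "Sigma1_form n \<phi> \<Longrightarrow> Pi1_form (Suc n) \<phi>"
| Sigma1_Ex: "Sigma1_form (Suc n) \<phi> \<Longrightarrow> Sigma1_form (Suc n) (ExF g \<phi>)"
| Pi1_All: "Pi1_form (Suc n) \<phi> \<Longrightarrow> Pi1_form (Suc n) (AllF g \<phi>)"

text \<open>
  The formula may depend on the number variable \<open>0\<close> only, which stands for the candidate element;
  in particular there are no number or function parameters (the hierarchy is the lightface one).
\<close>

definition defines_set :: "form \<Rightarrow> nat set \<Rightarrow> bool" where
  "defines_set \<phi> A \<longleftrightarrow> (\<forall>v w. holds v w \<phi> \<longleftrightarrow> v 0 \<in> A)"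

definition Sigma1 :: "nat \<Rightarrow> nat set set" where
  "Sigma1 n = {A. \<exists>\<phi>. Sigma1_form n \<phi> \<and> defines_set \<phi> A}"

definition Pi1 :: "nat \<Rightarrow> nat set set" where
  "Pi1 n = {A. \<exists>\<phi>. Pi1_form n \<phi> \<and> defines_set \<phi> A}"


section \<open>Goedel numbering of instances\<close>

primrec code_srt :: "srt \<Rightarrow> nat" where
  "code_srt Bit = 0"
| "code_srt Stream = 1"

primrec code_sym :: "sym \<Rightarrow> nat" where
  "code_sym Zero = 0"
| "code_sym One = 1"
| "code_sym SCons = 2"
| "code_sym (Fn f ss s) =
     3 + prod_encode (f, prod_encode (list_encode (map code_srt ss), code_srt s))"

primrec code_trm :: "trm \<Rightarrow> nat" where
  "code_trm (Var s x) = prod_encode (0, prod_encode (code_srt s, x))"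
| "code_trm (App f ts) =
     prod_encode (1, prod_encode (code_sym f, list_encode (map code_trm ts)))"

definition code_eqn :: "eqn \<Rightarrow> nat" where
  "code_eqn e = prod_encode (code_trm (fst e), code_trm (snd e))"

text \<open>
  In an instance, the finite signature and the finite set of equations are listed explicitly.
\<close>

type_synonym inst = "sym list \<times> eqn list \<times> trm \<times> trm"

fun code_inst :: "inst \<Rightarrow> nat" where
  "code_inst (\<Sigma>, E, s, t) =
     prod_encode (list_encode (map code_sym \<Sigma>),
       prod_encode (list_encode (map code_eqn E),
         prod_encode (code_trm s, code_trm t)))"

lemma code_srt_inj: "code_srt a = code_srt b \<longleftrightarrow> a = b"
  by (cases a; cases b) auto

lemma map_code_srt_inj: "map code_srt ss = map code_srt us \<longleftrightarrow> ss = us"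
  by (rule inj_map_eq_map) (simp add: inj_def code_srt_inj)

lemma code_sym_inj: "code_sym f = code_sym g \<longleftrightarrow> f = g"
  by (cases f; cases g) (simp_all add: code_srt_inj map_code_srt_inj list_encode_eq)

lemma map_code_sym_inj: "map code_sym fs = map code_sym gs \<longleftrightarrow> fs = gs"
  by (rule inj_map_eq_map) (simp add: inj_def code_sym_inj)

lemma code_trm_inj: "code_trm a = code_trm b \<longleftrightarrow> a = b"
proof (induction a arbitrary: b)
  case (Var s x)
  show ?case by (cases b) (simp_all add: code_srt_inj)
next
  case (App f ts)
  have "map code_trm ts = map code_trm us \<longleftrightarrow> ts = us" for us
    using App.IH
  proof (induction ts arbitrary: us)
    case Nil
    show ?case by auto
  next
    case (Cons a ts)
    then show ?case by (cases us) simp_all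
  qed
  then show ?case by (cases b) (simp_all add: code_sym_inj list_encode_eq)
qed

lemma code_eqn_inj: "code_eqn d = code_eqn e \<longleftrightarrow> d = e"
  by (cases d; cases e) (simp add: code_eqn_def code_trm_inj)

lemma map_code_eqn_inj: "map code_eqn ds = map code_eqn es \<longleftrightarrow> ds = es"
  by (rule inj_map_eq_map) (simp add: inj_def code_eqn_inj)

lemma inj_code_inst: "inj code_inst"
proof (rule injI)
  fix i j :: inst
  assume "code_inst i = code_inst j"
  moreover obtain S E s t where "i = (S, E, s, t)" by (cases i)
  moreover obtain S' E' s' t' where "j = (S', E', s', t')" by (cases j)
  ultimately show "i = j"
    by (simp add: code_trm_inj map_code_sym_inj map_code_eqn_inj list_encode_eq)
qed


section \<open>The problem of equality in all models\<close>

fun well_formed :: "inst \<Rightarrow> bool" where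
  "well_formed (\<Sigma>, E, s, t) \<longleftrightarrow>
     bitstream_signature (set \<Sigma>) \<and> equational_spec (set \<Sigma>) (set E) \<and>
     has_sort (set \<Sigma>) s Stream \<and> has_sort (set \<Sigma>) t Stream"

fun yes_instance :: "inst \<Rightarrow> bool" where
  "yes_instance (\<Sigma>, E, s, t) \<longleftrightarrow> equal_in_all_models (set \<Sigma>) (set E) s t"

definition equality_problem :: problem where
  "equality_problem =
     (code_inst ` {i. well_formed i}, code_inst ` {i. well_formed i \<and> yes_instance i})"

end

theory Submission
  imports Defs "HOL-Library.Countable_Set"
begin

text \<open>
  Hardness: bitstreams and universally valid equations can express first-order arithmetic exactly.
  A number \<open>n\<close> is the stream of \<open>n\<close> ones followed by zeros.  Since the elements of a stream algebra
  are genuine streams, two equations force an operation to test a stream for being constantly one,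
  and an operation listing the truth values of \<open>\<theta>\<close> at \<open>0, 1, 2, \<dots>\<close> as a stream then turns a universal
  quantifier into this test.  The interpretation of a fresh unary operation is an arbitrary function,
  so that quantifying over all models quantifies over all functions.

  Membership: the submodel generated by the values of an assignment is countable, and satisfies the
  same equations.  Hence a counterexample can be coded by functions on the natural numbers, and
  being such a code is arithmetical.
\<close>

text \<open>What lifts the problem beyond first-order consequence is that carriers consist of
  genuine streams: every position is finitely many tails away from the front, so induction over
  positions is available in every model. The obstacle on the hardness side is that the set of
  streams is arbitrary. Which streams belong to it is known only through the operations that return
  them, and a fresh operation may return streams that are not numbers; hence its values are
  normalised. Conversely, in the model built from given functions the equations must also hold when
  variables denote streams that are not numbers, so formulas need a meaning there too. On the
  membership side the obstacle is the phrase "for all assignments": as a function quantifier below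
  the existential quantifiers over a countermodel it would leave
  \<open>\<Sigma>\<^sup>1\<^sub>1\<close>. It becomes a number quantifier over a countable family of
  assignments closed under changing one value, which suffices since a term has finitely many
  variables.\<close>

instance srt :: countable by countable_datatype
instance sym :: countable by countable_datatype
instance trm :: countable by countable_datatype

section \<open>Evaluation\<close>

lemma eval_in_carrier:
  assumes "stream_algebra \<Sigma> D I" and "assignment D \<alpha>" and "has_sort \<Sigma> t s"
  shows "eval I \<alpha> t \<in> carrier D s"
  using assms(3)
proof (induction rule: has_sort.induct)
  case (has_sort_Var s x)
  then show ?case using assms(2) by (simp add: assignment_def)
next
  case (has_sort_App f ts)
  have "list_all2 (\<lambda>v s. v \<in> carrier D s) (map (eval I \<alpha>) ts) (arg_sorts f)"
    using has_sort_App.IH by (auto simp: list_all2_conv_all_nth)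
  with has_sort_App.hyps assms(1) show ?case
    by (simp add: stream_algebra_def)
qed

section \<open>Countable countermodels\<close>

definition vcode :: "(nat \<Rightarrow> nat \<Rightarrow> bool) \<Rightarrow> val \<Rightarrow> nat" where
  "vcode e v = (case v of VBit b \<Rightarrow> of_bool b | VStream \<sigma> \<Rightarrow> inv e \<sigma>)"

primrec vdec :: "(nat \<Rightarrow> nat \<Rightarrow> bool) \<Rightarrow> srt \<Rightarrow> nat \<Rightarrow> val" where
  "vdec e Bit n = VBit (n \<noteq> 0)"
| "vdec e Stream n = VStream (e n)"

definition isbit :: "nat \<Rightarrow> bool" where
  "isbit n \<longleftrightarrow> n = 0 \<or> n = 1"

lemma vdec_in_carrier: "vdec e s n \<in> carrier (range e) s"
  by (cases s) auto

lemma vdec_vcode: "v \<in> carrier (range e) s \<Longrightarrow> vdec e s (vcode e v) = v"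
  by (cases s) (auto simp: vcode_def f_inv_into_f)

lemma vcode_vdec: "inj e \<Longrightarrow> (s = Bit \<Longrightarrow> isbit n) \<Longrightarrow> vcode e (vdec e s n) = n"
  by (cases s) (auto simp: vcode_def isbit_def)

lemma vcode_Bit: "v \<in> carrier D Bit \<Longrightarrow> isbit (vcode e v)"
  by (auto simp: vcode_def isbit_def)

text \<open>
  \<open>X\<close> enumerates injectively the streams of a countable model, and a value is coded by the bit or
  the index of the stream.  \<open>As a\<close> are assignments (maps on codes of variables), \<open>Ev a\<close> is
  the corresponding evaluation (a map on codes of terms), \<open>M a\<close> its extension to codes of lists, and
  \<open>F\<close> interprets the symbols. The zeros of \<open>P\<close> contain the codes of all suffixes of the list of
  equations.
\<close>

definition eval_clauses ::
  "(nat \<Rightarrow> nat \<Rightarrow> nat) \<Rightarrow> (nat \<Rightarrow> nat \<Rightarrow> nat)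
   \<Rightarrow> (nat \<Rightarrow> nat \<Rightarrow> nat) \<Rightarrow> (nat \<Rightarrow> nat \<Rightarrow> nat) \<Rightarrow> bool" where
  "eval_clauses As Ev F M \<longleftrightarrow>
     (\<forall>a y. Ev a (prod_encode (0, y)) = As a y) \<and>
     (\<forall>a f l. Ev a (prod_encode (1, prod_encode (f, l))) = F f (M a l)) \<and>
     (\<forall>a. M a 0 = 0) \<and>
     (\<forall>a t l. M a (Suc (prod_encode (t, l))) = Suc (prod_encode (Ev a t, M a l)))"

text \<open>The numerals are values of \<open>code_sym\<close>, the first clause being about symbols
  with result sort \<open>Bit\<close>, whose codes end in 0. Stream-valued symbols get no such
  clause since every number is the index of a stream.\<close>

definition symbol_clauses ::
  "(nat \<Rightarrow> nat \<Rightarrow> nat) \<Rightarrow> (nat \<Rightarrow> nat \<Rightarrow> nat) \<Rightarrow> bool" where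
  "symbol_clauses X F \<longleftrightarrow>
     (\<forall>f ss l. isbit (F (Suc (Suc (Suc (prod_encode (f, prod_encode (ss, 0)))))) l)) \<and>
     F 0 0 = 0 \<and> F 1 0 = 1 \<and>
     (\<forall>b i. isbit b \<longrightarrow>
        X (F 2 (Suc (prod_encode (b, Suc (prod_encode (i, 0)))))) 0 = b \<and>
        (\<forall>k. X (F 2 (Suc (prod_encode (b, Suc (prod_encode (i, 0)))))) (Suc k) = X i k))"

text \<open>Any assignment can be matched on a finite set of variables by successive changes of one
  value. The premise on \<open>d\<close> keeps the values of bit variables, whose codes have first
  component 0, among the bits.\<close>

definition assignment_clauses ::
  "(nat \<Rightarrow> nat \<Rightarrow> nat) \<Rightarrow> bool" where
  "assignment_clauses As \<longleftrightarrow>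
     (\<forall>a x. isbit (As a (prod_encode (0, x)))) \<and>
     (\<forall>a y d. (\<forall>x. y = prod_encode (0, x) \<longrightarrow> isbit d) \<longrightarrow>
        (\<exists>b. As b y = d \<and> (\<forall>z. z = y \<or> As b z = As a z)))"

text \<open>Distinct indices denote distinct streams, so equality of values is equality of numbers.
  With \<open>P\<close>, validity of all listed equations is expressed without decoding the list:
  one step passes from a list to its tail.\<close>

definition countermodel ::
  "(nat \<Rightarrow> nat \<Rightarrow> nat) \<Rightarrow> (nat \<Rightarrow> nat \<Rightarrow> nat) \<Rightarrow> (nat \<Rightarrow> nat \<Rightarrow> nat)
    \<Rightarrow> (nat \<Rightarrow> nat \<Rightarrow> nat) \<Rightarrow> (nat \<Rightarrow> nat \<Rightarrow> nat) \<Rightarrow> (nat \<Rightarrow> nat) \<Rightarrow> nat \<Rightarrow> bool" where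
  "countermodel X As Ev F M P n \<longleftrightarrow>
     (\<forall>i k. isbit (X i k)) \<and> (\<forall>i j. (\<forall>k. X i k = X j k) \<longrightarrow> i = j) \<and>
     assignment_clauses As \<and> eval_clauses As Ev F M \<and> symbol_clauses X F \<and>
     (\<forall>e d l. P (Suc (prod_encode (prod_encode (e, d), l))) = 0 \<longrightarrow>
         P l = 0 \<and> (\<forall>a. Ev a e = Ev a d)) \<and>
     (\<exists>\<Sigma> E s t a. n = prod_encode (\<Sigma>, prod_encode (E, prod_encode (s, t))) \<and>
         P E = 0 \<and> Ev a s \<noteq> Ev a t)"

section \<open>Reading a model off a coded countermodel\<close>

primrec tvars :: "trm \<Rightarrow> (srt \<times> nat) set" where
  "tvars (Var s x) = {(s, x)}"
| "tvars (App f ts) = \<Union> (set (map tvars ts))"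

lemma finite_tvars: "finite (tvars t)"
  by (induction t) auto

text \<open>Both sides obey the same recursion on terms. Agreement is required on the variables of
  \<open>t\<close> only, because the family \<open>As\<close> need not contain a code of the whole
  assignment.\<close>

lemma eval_code:
  assumes alg: "stream_algebra \<Sigma> (range e) I"
    and ev: "eval_clauses As Ev F M"
    and F: "\<And>f vs. f \<in> \<Sigma> \<Longrightarrow> list_all2 (\<lambda>v s. v \<in> carrier (range e) s) vs (arg_sorts f) \<Longrightarrow>
        F (code_sym f) (list_encode (map (vcode e) vs)) = vcode e (I f vs)"
    and \<alpha>: "assignment (range e) \<alpha>"
    and t: "has_sort \<Sigma> t s"
    and vars: "\<And>s x. (s, x) \<in> tvars t \<Longrightarrow> As a (prod_encode (code_srt s, x)) = vcode e (\<alpha> s x)"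
  shows "Ev a (code_trm t) = vcode e (eval I \<alpha> t)"
  using t vars
proof (induction rule: has_sort.induct)
  case (has_sort_Var s x)
  then show ?case using ev by (simp add: eval_clauses_def)
next
  case (has_sort_App f ts)
  have IH: "Ev a (code_trm t) = vcode e (eval I \<alpha> t) \<and> eval I \<alpha> t \<in> carrier (range e) s"
    if "(t, s) \<in> set (zip ts (arg_sorts f))" for t s
  proof -
    from that has_sort_App.IH have *: "has_sort \<Sigma> t s"
      "(\<And>s x. (s, x) \<in> tvars t \<Longrightarrow> As a (prod_encode (code_srt s, x)) = vcode e (\<alpha> s x)) \<Longrightarrow>
         Ev a (code_trm t) = vcode e (eval I \<alpha> t)"
      by (auto simp: list_all2_iff)
    from that have "t \<in> set ts" by (rule set_zip_leftD)
    then have "tvars t \<subseteq> tvars (App f ts)" by auto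
    with * has_sort_App.prems eval_in_carrier[OF alg \<alpha> *(1)] show ?thesis
      by blast
  qed
  have len: "length ts = length (arg_sorts f)"
    using has_sort_App.IH by (simp add: list_all2_iff)
  have sorted: "list_all2 (\<lambda>v s. v \<in> carrier (range e) s) (map (eval I \<alpha>) ts) (arg_sorts f)"
    using IH len by (auto simp: list_all2_conv_all_nth set_zip)
  have "Ev a (code_trm t) = vcode e (eval I \<alpha> t)" if "t \<in> set ts" for t
    using IH len that by (metis in_set_impl_in_set_zip1)
  then have "M a (list_encode (map code_trm ts)) = list_encode (map (vcode e) (map (eval I \<alpha>) ts))"
    using ev unfolding eval_clauses_def by (induction ts) auto
  with ev F[OF has_sort_App.hyps(1) sorted] show ?case
    by (simp add: eval_clauses_def)
qed

lemma countermodel_imp_no: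
  assumes cm: "countermodel X As Ev F M P (code_inst (\<Sigma>, E, s, t))"
    and wf: "well_formed (\<Sigma>, E, s, t)"
  shows "\<not> yes_instance (\<Sigma>, E, s, t)"
proof -
  define e where "e i k \<longleftrightarrow> X i k \<noteq> 0" for i k :: nat
  \<comment> \<open>Decoding at the result sort puts every value into the carrier, also on argument
    lists that do not fit the symbol.\<close>
  define I where "I f vs =
     (case f of Zero \<Rightarrow> VBit False | One \<Rightarrow> VBit True
      | _ \<Rightarrow> vdec e (res_sort f) (F (code_sym f) (list_encode (map (vcode e) vs))))" for f vs
  have X: "isbit (X i k)" for i k using cm unfolding countermodel_def by blast
  have As: "assignment_clauses As" and ev: "eval_clauses As Ev F M" and sc: "symbol_clauses X F"
    and P: "\<And>c d l. P (Suc (prod_encode (prod_encode (c, d), l))) = 0 \<Longrightarrow>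
         P l = 0 \<and> (\<forall>a. Ev a c = Ev a d)"
    using cm unfolding countermodel_def by blast+
  have inj: "inj e"
  proof (rule injI)
    fix i j assume "e i = e j"
    then have "e i k = e j k" for k by simp
    then have "X i k = X j k" for k
      using X[of i k] X[of j k] unfolding e_def isbit_def by metis
    then show "i = j" using cm unfolding countermodel_def by blast
  qed
  let ?D = "range e"
  have I_carrier: "I f vs \<in> carrier ?D (res_sort f)" for f vs
    by (cases f) (auto simp: I_def vdec_in_carrier)
  have cons: "I SCons [VBit x, VStream (e i)] = VStream (case_nat x (e i))" for x i
  proof -
    have "e (F 2 (Suc (prod_encode (of_bool x, Suc (prod_encode (i, 0)))))) = case_nat x (e i)"
    proof
      fix k
      show "e (F 2 (Suc (prod_encode (of_bool x, Suc (prod_encode (i, 0)))))) k = case_nat x (e i) k"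
        using sc by (cases k) (auto simp: symbol_clauses_def e_def isbit_def)
    qed
    then show ?thesis using inj by (simp add: I_def vcode_def)
  qed
  have alg: "stream_algebra (set \<Sigma>) ?D I"
    unfolding stream_algebra_def using I_carrier cons by (auto simp: I_def)
  have bitF: "isbit (F (Suc (Suc (Suc (prod_encode (f, prod_encode (ss, 0)))))) l)" for f ss l
    using sc by (simp add: symbol_clauses_def)
  have F: "F (code_sym f) (list_encode (map (vcode e) vs)) = vcode e (I f vs)"
    if "list_all2 (\<lambda>v s. v \<in> carrier ?D s) vs (arg_sorts f)" for f vs
  proof (cases f)
    case (Fn g ss r)
    define n where "n = F (code_sym f) (list_encode (map (vcode e) vs))"
    have "I f vs = vdec e r n" by (simp add: I_def Fn n_def)
    moreover have "r = Bit \<Longrightarrow> isbit n"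
      using bitF by (simp add: n_def Fn numeral_3_eq_3)
    ultimately show ?thesis using vcode_vdec[OF inj] n_def by simp
  qed (use that sc inj in \<open>auto simp: symbol_clauses_def I_def vcode_def\<close>)
  have code: "Ev a (code_trm u) = vcode e (eval I \<alpha> u)"
    if "assignment ?D \<alpha>" "has_sort (set \<Sigma>) u r"
      "\<And>s x. (s, x) \<in> tvars u \<Longrightarrow> As a (prod_encode (code_srt s, x)) = vcode e (\<alpha> s x)" for \<alpha> a u r
    using eval_code[OF alg ev F that] by blast
  \<comment> \<open>Start from any member of the family and correct it at one variable of
    \<open>V\<close> after the other.\<close>
  have approx: "\<exists>a. \<forall>(s, x)\<in>V. As a (prod_encode (code_srt s, x)) = vcode e (\<alpha> s x)"
    if "finite V" "assignment ?D \<alpha>" for V \<alpha>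
    using that(1)
  proof (induction V rule: finite_induct)
    case (insert y V)
    then obtain a where a: "\<forall>(s, x)\<in>V. As a (prod_encode (code_srt s, x)) = vcode e (\<alpha> s x)"
      by blast
    obtain r z where y: "y = (r, z)" by (cases y)
    have "isbit (vcode e (\<alpha> Bit z))"
      using that(2) unfolding assignment_def by (intro vcode_Bit) blast
    then have "\<forall>x. prod_encode (code_srt r, z) = prod_encode (0, x) \<longrightarrow> isbit (vcode e (\<alpha> r z))"
      by (cases r) auto
    then obtain b where b: "As b (prod_encode (code_srt r, z)) = vcode e (\<alpha> r z)"
        "\<forall>u. u = prod_encode (code_srt r, z) \<or> As b u = As a u"
      using As unfolding assignment_clauses_def by blast
    have "As b (prod_encode (code_srt s, x)) = vcode e (\<alpha> s x)" if "(s, x) \<in> insert y V" for s x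
    proof (cases "(s, x) = (r, z)")
      case False
      then have "As b (prod_encode (code_srt s, x)) = As a (prod_encode (code_srt s, x))"
        using b(2)[rule_format, of "prod_encode (code_srt s, x)"] by (auto simp: code_srt_inj)
      then show ?thesis using a that False y by auto
    qed (use b(1) in simp)
    then show ?case by blast
  qed simp
  obtain a where PE: "P (list_encode (map code_eqn E)) = 0"
    and ne: "Ev a (code_trm s) \<noteq> Ev a (code_trm t)"
    using cm unfolding countermodel_def code_inst.simps by (metis Pair_inject prod_encode_eq)
  have all_eqs: "\<forall>a. Ev a (code_trm (fst q)) = Ev a (code_trm (snd q))" if "q \<in> set E" for q
    using PE that
  proof (induction E)
    case (Cons c E)
    then have "P (list_encode (map code_eqn E)) = 0"
        "\<forall>a. Ev a (code_trm (fst c)) = Ev a (code_trm (snd c))"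
      using P[of "code_trm (fst c)" "code_trm (snd c)" "list_encode (map code_eqn E)"]
      by (simp_all add: code_eqn_def[of c])
    with Cons show ?case by auto
  qed simp
  have sat: "satisfies ?D I q" if q: "q \<in> set E" for q
    unfolding satisfies_def
  proof (intro allI impI)
    fix \<alpha> assume \<alpha>: "assignment ?D \<alpha>"
    obtain l r where lr: "q = (l, r)" by (cases q)
    obtain so where so: "has_sort (set \<Sigma>) l so" "has_sort (set \<Sigma>) r so"
      using wf q lr by (auto simp: equational_spec_def)
    obtain a where a: "\<forall>(s, x)\<in>tvars l \<union> tvars r. As a (prod_encode (code_srt s, x)) = vcode e (\<alpha> s x)"
      using approx[OF _ \<alpha>, of "tvars l \<union> tvars r"] finite_tvars by auto
    have "vcode e (eval I \<alpha> l) = vcode e (eval I \<alpha> r)"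
      using code[OF \<alpha> so(1), of a] code[OF \<alpha> so(2), of a] a all_eqs[OF q] lr by fastforce
    then show "eval I \<alpha> (fst q) = eval I \<alpha> (snd q)"
      using vdec_vcode[OF eval_in_carrier[OF alg \<alpha> so(1)]]
        vdec_vcode[OF eval_in_carrier[OF alg \<alpha> so(2)]] lr by (metis fst_conv snd_conv)
  qed
  define \<alpha> where "\<alpha> s x = vdec e s (As a (prod_encode (code_srt s, x)))" for s x
  have \<alpha>: "assignment ?D \<alpha>"
    by (simp add: assignment_def \<alpha>_def vdec_in_carrier)
  have *: "As a (prod_encode (code_srt s, x)) = vcode e (\<alpha> s x)" for s x
    unfolding \<alpha>_def using As
    by (intro vcode_vdec[OF inj, symmetric]) (auto simp: assignment_clauses_def)
  have "eval I \<alpha> s \<noteq> eval I \<alpha> t"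
    using code[OF \<alpha>, of s Stream a] code[OF \<alpha>, of t Stream a] * wf ne by auto
  with \<alpha> have "\<not> satisfies ?D I (s, t)"
    by (auto simp: satisfies_def)
  moreover have "stream_model (set \<Sigma>) (set E) ?D I"
    using alg sat by (simp add: stream_model_def)
  ultimately show ?thesis
    unfolding yes_instance.simps equal_in_all_models_def by blast
qed

section \<open>Coding a countable countermodel\<close>

lemma case_nat_eq_iff: "case_nat b \<sigma> = case_nat c \<tau> \<longleftrightarrow> b = c \<and> \<sigma> = \<tau>"
proof
  assume *: "case_nat b \<sigma> = case_nat c \<tau>"
  from fun_cong[OF *, of 0] fun_cong[OF *, of "Suc k" for k] show "b = c \<and> \<sigma> = \<tau>"
    by (auto simp: fun_eq_iff)
qed simp

lemma stream_algebra_case_nat: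
  assumes "stream_algebra \<Sigma> D I" and "SCons \<in> \<Sigma>" and "\<sigma> \<in> D"
  shows "case_nat b \<sigma> \<in> D"
proof -
  have "list_all2 (\<lambda>v s. v \<in> carrier D s) [VBit b, VStream \<sigma>] (arg_sorts SCons)"
    using assms(3) by simp
  with assms have "I SCons [VBit b, VStream \<sigma>] \<in> carrier D (res_sort SCons)"
    unfolding stream_algebra_def by blast
  with assms show ?thesis by (auto simp: stream_algebra_def)
qed

text \<open>Prepending a bit injects two disjoint copies of \<open>D\<close> into \<open>D\<close>.
  A countable carrier is therefore enumerated without repetition by all of \<open>nat\<close>, as
  \<open>X\<close> has to be.\<close>

lemma stream_algebra_infinite:
  assumes "stream_algebra \<Sigma> D I" and "SCons \<in> \<Sigma>"
  shows "infinite D"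
proof
  assume fin: "finite D"
  have inj: "inj_on (\<lambda>(b, \<sigma>). case_nat b \<sigma>) (UNIV \<times> D)"
    by (auto simp: inj_on_def case_nat_eq_iff)
  have "card ((UNIV :: bool set) \<times> D) \<le> card D"
    using stream_algebra_case_nat[OF assms] by (intro card_inj_on_le[OF inj _ fin]) auto
  moreover have "card D > 0" using assms fin by (auto simp: stream_algebra_def card_gt_0_iff)
  ultimately show False by (simp add: card_cartesian_product)
qed

lemma list_decode_less: "x \<in> set (list_decode n) \<Longrightarrow> x < n"
proof (induction n rule: less_induct)
  case (less n)
  show ?case
  proof (cases n)
    case (Suc m)
    obtain a b where ab: "prod_decode m = (a, b)" by (cases "prod_decode m")
    then have m: "m = prod_encode (a, b)" by (metis prod_decode_inverse)
    have "a \<le> m" "b \<le> m" unfolding m by (rule le_prod_encode_1 le_prod_encode_2)+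
    with less Suc ab show ?thesis by (force simp: less_Suc_eq_le)
  qed (use less in simp)
qed

text \<open>
  Extension of an interpretation \<open>F\<close> of the symbols to all numbers, so that the
  equations required of \<open>Ev\<close> hold on numbers that are not codes of well-sorted terms, too.
\<close>

function evalc :: "(nat \<Rightarrow> nat \<Rightarrow> nat) \<Rightarrow> (nat \<Rightarrow> nat) \<Rightarrow> nat \<Rightarrow> nat" where
  "evalc F A c =
     (if fst (prod_decode c) = 0 then A (snd (prod_decode c))
      else if fst (prod_decode c) = 1 then
        F (fst (prod_decode (snd (prod_decode c))))
          (list_encode (map (evalc F A) (list_decode (snd (prod_decode (snd (prod_decode c)))))))
      else 0)"
  by auto
termination
proof (relation "measure (\<lambda>(F, A, c). c)")
  fix c x :: nat and F :: "nat \<Rightarrow> nat \<Rightarrow> nat" and A :: "nat \<Rightarrow> nat"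
  assume "x \<in> set (list_decode (snd (prod_decode (snd (prod_decode c)))))"
  then have "x < snd (prod_decode (snd (prod_decode c)))" by (rule list_decode_less)
  also have "\<dots> \<le> snd (prod_decode c)"
    by (metis le_prod_encode_2 prod.collapse prod_decode_inverse)
  also have "\<dots> \<le> c"
    by (metis le_prod_encode_2 prod.collapse prod_decode_inverse)
  finally show "((F, A, x), (F, A, c)) \<in> measure (\<lambda>(F, A, c). c)" by simp
qed simp

declare evalc.simps [simp del]

lemma eval_clauses_evalc:
  "eval_clauses As (\<lambda>a. evalc F (As a)) F
     (\<lambda>a l. list_encode (map (evalc F (As a)) (list_decode l)))"
  unfolding eval_clauses_def by (simp add: evalc.simps[of _ _ "prod_encode _"])

lemma no_imp_countermodel:
  assumes wf: "well_formed (\<Sigma>, E, s, t)"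
    and no: "\<not> yes_instance (\<Sigma>, E, s, t)"
  shows "\<exists>X As Ev F M P. countermodel X As Ev F M P (code_inst (\<Sigma>, E, s, t))"
proof -
  obtain D0 I \<alpha>0 where alg0: "stream_algebra (set \<Sigma>) D0 I"
    and E0: "\<And>q. q \<in> set E \<Longrightarrow> satisfies D0 I q"
    and \<alpha>0: "assignment D0 \<alpha>0" and ne: "eval I \<alpha>0 s \<noteq> eval I \<alpha>0 t"
    using no unfolding yes_instance.simps equal_in_all_models_def stream_model_def satisfies_def
    by (metis fst_conv snd_conv)
  have sig: "Zero \<in> set \<Sigma>" "One \<in> set \<Sigma>" "SCons \<in> set \<Sigma>"
    using wf by (auto simp: bitstream_signature_def)
  define D where "D = {\<sigma>. \<exists>u. has_sort (set \<Sigma>) u Stream \<and> eval I \<alpha>0 u = VStream \<sigma>}"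
  have gen: "\<exists>u. has_sort (set \<Sigma>) u r \<and> eval I \<alpha>0 u = v" if v: "v \<in> carrier D r" for v r
  proof (cases r)
    case Bit
    then obtain b where b: "v = VBit b" using v by auto
    have "has_sort (set \<Sigma>) (App (if b then One else Zero) []) Bit"
      using has_sort_App[of One "set \<Sigma>" "[]"] has_sort_App[of Zero "set \<Sigma>" "[]"] sig by auto
    moreover have "eval I \<alpha>0 (App (if b then One else Zero) []) = v"
      using alg0 b by (auto simp: stream_algebra_def)
    ultimately show ?thesis using Bit by blast
  qed (use v in \<open>auto simp: D_def\<close>)
  have sub: "D \<subseteq> D0"
    using eval_in_carrier[OF alg0 \<alpha>0] by (fastforce simp: D_def)
  have car: "v \<in> carrier D r" if "has_sort (set \<Sigma>) u r" "eval I \<alpha>0 u = v" for u r v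
    using eval_in_carrier[OF alg0 \<alpha>0 that(1)] that by (cases r) (auto simp: D_def)
  have closed: "I f vs \<in> carrier D (res_sort f)"
    if f: "f \<in> set \<Sigma>" and vs: "list_all2 (\<lambda>v s. v \<in> carrier D s) vs (arg_sorts f)" for f vs
  proof -
    have "\<forall>i<length vs. \<exists>u. has_sort (set \<Sigma>) u (arg_sorts f ! i) \<and> eval I \<alpha>0 u = vs ! i"
      using vs gen by (auto simp: list_all2_conv_all_nth)
    then obtain us where us: "length us = length vs"
        "\<forall>i<length vs. has_sort (set \<Sigma>) (us ! i) (arg_sorts f ! i) \<and> eval I \<alpha>0 (us ! i) = vs ! i"
      using Skolem_list_nth[of "length vs" "\<lambda>i u. has_sort (set \<Sigma>) u (arg_sorts f ! i) \<and> eval I \<alpha>0 u = vs ! i"]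
      by blast
    have "has_sort (set \<Sigma>) (App f us) (res_sort f)"
      using us vs by (intro has_sort_App f) (auto simp: list_all2_conv_all_nth)
    moreover have "eval I \<alpha>0 (App f us) = I f vs"
      using us by (simp add: nth_equalityI cong: map_cong) (metis length_map nth_equalityI nth_map)
    ultimately show ?thesis by (rule car)
  qed
  have \<alpha>D: "assignment D \<alpha>0"
    by (auto simp: assignment_def intro: car[OF has_sort_Var])
  have "D \<noteq> {}" using \<alpha>D[unfolded assignment_def, rule_format, of Stream 0] by auto
  with closed alg0 sub have alg1: "stream_algebra (set \<Sigma>) D I"
    by (auto simp: stream_algebra_def)
  have "D \<subseteq> range (\<lambda>u. case eval I \<alpha>0 u of VStream \<sigma> \<Rightarrow> \<sigma>)"
  proof
    fix \<sigma> assume "\<sigma> \<in> D"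
    then obtain u where "eval I \<alpha>0 u = VStream \<sigma>" by (auto simp: D_def)
    then have "\<sigma> = (case eval I \<alpha>0 u of VStream \<sigma> \<Rightarrow> \<sigma>)" by simp
    then show "\<sigma> \<in> range (\<lambda>u. case eval I \<alpha>0 u of VStream \<sigma> \<Rightarrow> \<sigma>)" by (rule range_eqI)
  qed
  then have "countable D" by (rule countable_subset) simp
  with stream_algebra_infinite[OF alg1 sig(3)] obtain e :: "nat \<Rightarrow> nat \<Rightarrow> bool"
    where e: "bij_betw e UNIV D"
    using bij_betw_from_nat_into by blast
  then have inj: "inj e" and D: "D = range e" by (auto simp: bij_betw_def)
  note alg = alg1[unfolded D]
  define X :: "nat \<Rightarrow> nat \<Rightarrow> nat" where "X i k = of_bool (e i k)" for i k
  \<comment> \<open>Decoding the arguments at the argument sorts makes every list of the right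
    length fit the type. The default 0 is a bit as well as an index, so it violates no
    clause.\<close>
  define F where "F c l = (if \<exists>f\<in>set \<Sigma>. c = code_sym f \<and> length (list_decode l) = length (arg_sorts f)
      then let f = (THE f. c = code_sym f)
           in vcode e (I f (map2 (vdec e) (arg_sorts f) (list_decode l))) else 0)" for c l
  \<comment> \<open>Read as a list, \<open>a\<close> records finitely many changes to
    \<open>\<alpha>0\<close>, the newest in front; consing a pair is the required single change.
    Truncation by \<open>min d 1\<close> makes arbitrary lists respect bit variables, and
    \<open>a = 0\<close>, the empty list, gives back \<open>\<alpha>0\<close>.\<close>
  define As where "As a y = (let d = (case map_of (map prod_decode (list_decode a)) y of
        Some d \<Rightarrow> d | None \<Rightarrow> (let (r, x) = prod_decode y in vcode e (\<alpha>0 (if r = 0 then Bit else Stream) x)))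
      in if fst (prod_decode y) = 0 then min d 1 else d)" for a y
  define Ev where "Ev a = evalc F (As a)" for a
  define M where "M a l = list_encode (map (evalc F (As a)) (list_decode l))" for a l
  \<comment> \<open>Codes of lists of equations taken from \<open>E\<close>, a property that is
    inherited by tails.\<close>
  define P :: "nat \<Rightarrow> nat" where "P l = (if \<exists>E'. set E' \<subseteq> set E \<and> l = list_encode (map code_eqn E') then 0 else 1)" for l
  have ev: "eval_clauses As Ev F M"
    unfolding Ev_def M_def by (rule eval_clauses_evalc)
  have carD: "map2 (vdec e) ss ns = vs \<Longrightarrow> length ns = length ss \<Longrightarrow>
      list_all2 (\<lambda>v s. v \<in> carrier D s) vs ss" for ss ns vs
    by (auto simp: list_all2_conv_all_nth D vdec_in_carrier)
  have F_code: "F (code_sym f) l = (if f \<in> set \<Sigma> \<and> length (list_decode l) = length (arg_sorts f)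
      then vcode e (I f (map2 (vdec e) (arg_sorts f) (list_decode l))) else 0)" for f l
    by (auto simp: F_def code_sym_inj)
  have F: "F (code_sym f) (list_encode (map (vcode e) vs)) = vcode e (I f vs)"
    if f: "f \<in> set \<Sigma>" and vs: "list_all2 (\<lambda>v s. v \<in> carrier (range e) s) vs (arg_sorts f)" for f vs
  proof -
    have "map2 (vdec e) (arg_sorts f) (map (vcode e) vs) = vs"
      using vs by (auto simp: list_all2_conv_all_nth vdec_vcode intro!: nth_equalityI)
    then show ?thesis
      using f vs by (simp add: F_code list_all2_lengthD)
  qed
  have Fbit: "isbit (F (Suc (Suc (Suc (prod_encode (f, prod_encode (ss, 0)))))) l)" for f ss l
  proof (cases "\<exists>g\<in>set \<Sigma>. Suc (Suc (Suc (prod_encode (f, prod_encode (ss, 0))))) = code_sym g \<and>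
        length (list_decode l) = length (arg_sorts g)")
    case True
    then obtain g where g: "g \<in> set \<Sigma>" "Suc (Suc (Suc (prod_encode (f, prod_encode (ss, 0))))) = code_sym g"
        "length (list_decode l) = length (arg_sorts g)" by blast
    have "res_sort g = Bit"
    proof (cases g)
      case (Fn h us r)
      then show ?thesis using g(2) by (cases r) (auto simp: numeral_3_eq_3)
    qed (use g(2) in \<open>auto simp: numeral_2_eq_2\<close>)
    with closed[OF g(1) carD[OF refl g(3)]] have
      "isbit (vcode e (I g (map2 (vdec e) (arg_sorts g) (list_decode l))))"
      by (intro vcode_Bit[of _ D]) metis
    with g show ?thesis unfolding g(2) by (simp add: F_code)
  qed (auto simp: F_def isbit_def)
  have I_simps: "I Zero [] = VBit False" "I One [] = VBit True"
      "\<And>x i. I SCons [VBit x, VStream (e i)] = VStream (case_nat x (e i))"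
    using alg by (auto simp: stream_algebra_def)
  have Fcons: "e (F 2 (Suc (prod_encode (b, Suc (prod_encode (i, 0)))))) = case_nat (b \<noteq> 0) (e i)" for b i
  proof -
    have "I SCons [VBit (b \<noteq> 0), VStream (e i)] \<in> carrier D Stream"
      using closed[OF sig(3), of "[VBit (b \<noteq> 0), VStream (e i)]"] by (auto simp: D)
    then show ?thesis
      using F_code[of SCons "Suc (prod_encode (b, Suc (prod_encode (i, 0))))"] sig
      by (simp add: I_simps vcode_def D image_iff) (metis (no_types, lifting) f_inv_into_f rangeI)
  qed
  have sym: "symbol_clauses X F"
    unfolding symbol_clauses_def
    using Fbit F_code[of Zero 0] F_code[of One 0] sig Fcons
    by (auto simp: I_simps vcode_def X_def isbit_def)
  have asg: "assignment_clauses As"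
    unfolding assignment_clauses_def
  proof (intro conjI allI impI)
    show "isbit (As a (prod_encode (0, x)))" for a x
      by (auto simp: As_def isbit_def Let_def min_def)
  next
    fix a y d assume *: "\<forall>x. y = prod_encode (0, x) \<longrightarrow> isbit d"
    have "fst (prod_decode y) = 0 \<Longrightarrow> isbit d"
      using * by (metis prod.collapse prod_decode_inverse)
    then have "As (Suc (prod_encode (prod_encode (y, d), a))) y = d"
      by (auto simp: As_def isbit_def)
    moreover have "z = y \<or> As (Suc (prod_encode (prod_encode (y, d), a))) z = As a z" for z
      by (auto simp: As_def)
    ultimately show "\<exists>b. As b y = d \<and> (\<forall>z. z = y \<or> As b z = As a z)" by blast
  qed
  have code: "Ev a (code_trm u) = vcode e (eval I (\<lambda>s x. vdec e s (As a (prod_encode (code_srt s, x)))) u)"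
    if "has_sort (set \<Sigma>) u r" for a u r
  proof (rule eval_code[OF alg ev F _ that])
    show "assignment (range e) (\<lambda>s x. vdec e s (As a (prod_encode (code_srt s, x))))"
      by (simp add: assignment_def vdec_in_carrier)
    show "As a (prod_encode (code_srt s, x)) =
        vcode e (vdec e s (As a (prod_encode (code_srt s, x))))" for s x
      using asg by (intro vcode_vdec[OF inj, symmetric]) (auto simp: assignment_clauses_def)
  qed
  \<comment> \<open>An assignment into the generated subalgebra is one into \<open>D0\<close>, so
    universally valid equations are inherited.\<close>
  have eqs: "Ev a (code_trm l) = Ev a (code_trm r)" if lr: "(l, r) \<in> set E" for l r a
  proof -
    obtain so where so: "has_sort (set \<Sigma>) l so" "has_sort (set \<Sigma>) r so"
      using wf lr by (auto simp: equational_spec_def)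
    have "vdec e s n \<in> carrier D0 s" for s n
      using sub D by (cases s) auto
    then have "assignment D0 (\<lambda>s x. vdec e s (As a (prod_encode (code_srt s, x))))"
      by (simp add: assignment_def)
    then show ?thesis
      using E0[OF lr] code[OF so(1)] code[OF so(2)] by (simp add: satisfies_def)
  qed
  have "vdec e r (As 0 (prod_encode (code_srt r, x))) = \<alpha>0 r x" for r x
  proof -
    have c: "\<alpha>0 r x \<in> carrier (range e) r" using \<alpha>D D by (simp add: assignment_def)
    then have "As 0 (prod_encode (code_srt r, x)) = vcode e (\<alpha>0 r x)"
      using vcode_Bit[of "\<alpha>0 r x" "range e" e] by (cases r) (auto simp: As_def min_def isbit_def)
    then show ?thesis using vdec_vcode[OF c] by simp
  qed
  moreover have st: "has_sort (set \<Sigma>) s Stream" "has_sort (set \<Sigma>) t Stream" using wf by auto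
  ultimately have "Ev 0 (code_trm s) = vcode e (eval I \<alpha>0 s)" "Ev 0 (code_trm t) = vcode e (eval I \<alpha>0 t)"
    using code[OF st(1), of 0] code[OF st(2), of 0] by simp_all
  then have "Ev 0 (code_trm s) \<noteq> Ev 0 (code_trm t)"
    using ne vdec_vcode[OF eval_in_carrier[OF alg _ st(1)], of \<alpha>0]
      vdec_vcode[OF eval_in_carrier[OF alg _ st(2)], of \<alpha>0] \<alpha>D D by metis
  moreover have "P (list_encode (map code_eqn E)) = 0" by (auto simp: P_def)
  ultimately have wit: "\<exists>\<Sigma>' E' s' t' a. code_inst (\<Sigma>, E, s, t) =
      prod_encode (\<Sigma>', prod_encode (E', prod_encode (s', t'))) \<and> P E' = 0 \<and> Ev a s' \<noteq> Ev a t'"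
    by auto
  have P: "P l = 0 \<and> (\<forall>a. Ev a c = Ev a d)"
    if "P (Suc (prod_encode (prod_encode (c, d), l))) = 0" for c d l
  proof -
    from that obtain E' where E': "set E' \<subseteq> set E"
        "Suc (prod_encode (prod_encode (c, d), l)) = list_encode (map code_eqn E')"
      by (auto simp: P_def split: if_splits)
    then obtain q E'' where "E' = q # E''" by (cases E') auto
    with E' eqs show ?thesis by (cases q) (auto simp: P_def code_eqn_def)
  qed
  have "i = j" if "\<forall>k. X i k = X j k" for i j
    using that inj by (auto simp: X_def inj_def fun_eq_iff of_bool_eq_iff)
  moreover have "isbit (X i k)" for i k by (simp add: X_def isbit_def)
  ultimately have "countermodel X As Ev F M P (code_inst (\<Sigma>, E, s, t))"
    unfolding countermodel_def using asg ev sym P wit by blast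
  then show ?thesis by blast
qed

section \<open>The problem is \<open>\<Pi>\<^sup>1\<^sub>1\<close>\<close>

text \<open>The function variable \<open>0\<close> stands for the function \<^const>\<open>triangle\<close>, which makes pairing a term.\<close>

definition NPair :: "nterm \<Rightarrow> nterm \<Rightarrow> nterm" where
  "NPair a b = NAdd (NApp 0 (NAdd a b)) a"

definition NApp2 :: "nat \<Rightarrow> nterm \<Rightarrow> nterm \<Rightarrow> nterm" where
  "NApp2 g a b = NApp g (NPair a b)"

definition Imp :: "form \<Rightarrow> form \<Rightarrow> form" where
  "Imp \<phi> \<psi> = Neg (Conj \<phi> (Neg \<psi>))"

definition Disj :: "form \<Rightarrow> form \<Rightarrow> form" where
  "Disj \<phi> \<psi> = Neg (Conj (Neg \<phi>) (Neg \<psi>))"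

definition IsBit :: "nterm \<Rightarrow> form" where
  "IsBit a = Disj (Eq a NZero) (Eq a (NSuc NZero))"

lemma nval_NPair: "w 0 = triangle \<Longrightarrow> nval v w (NPair a b) = prod_encode (nval v w a, nval v w b)"
  by (simp add: NPair_def prod_encode_def)

lemma nval_NApp2:
  "w 0 = triangle \<Longrightarrow> nval v w (NApp2 g a b) = w g (prod_encode (nval v w a, nval v w b))"
  by (simp add: NApp2_def nval_NPair)

lemma holds_connectives:
  "holds v w (Imp \<phi> \<psi>) \<longleftrightarrow> (holds v w \<phi> \<longrightarrow> holds v w \<psi>)"
  "holds v w (Disj \<phi> \<psi>) \<longleftrightarrow> (holds v w \<phi> \<or> holds v w \<psi>)"
  "holds v w (IsBit a) \<longleftrightarrow> isbit (nval v w a)"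
  by (auto simp: Imp_def Disj_def IsBit_def isbit_def)

lemma arithmetical_connectives:
  "arithmetical (Imp \<phi> \<psi>) \<longleftrightarrow> arithmetical \<phi> \<and> arithmetical \<psi>"
  "arithmetical (Disj \<phi> \<psi>) \<longleftrightarrow> arithmetical \<phi> \<and> arithmetical \<psi>"
  "arithmetical (IsBit a)"
  by (auto simp: Imp_def Disj_def IsBit_def)

abbreviation (input) "nx \<equiv> NVar 1"
abbreviation (input) "ny \<equiv> NVar 2"
abbreviation (input) "nz \<equiv> NVar 3"
abbreviation (input) "nu \<equiv> NVar 4"
abbreviation (input) "nt \<equiv> NVar 5"
abbreviation (input) "fX \<equiv> 1::nat"
abbreviation (input) "fAs \<equiv> 2::nat"
abbreviation (input) "fEv \<equiv> 3::nat"
abbreviation (input) "fF \<equiv> 4::nat"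
abbreviation (input) "fM \<equiv> 5::nat"
abbreviation (input) "fP \<equiv> 6::nat"
abbreviation (input) "curried h i k \<equiv> h (prod_encode (i, k))"

text \<open>Twice a triangular number is a product of consecutive numbers; stating it doubled avoids
  division and determines the function uniquely.\<close>

definition triangle_form :: form where
  "triangle_form = AllN 1 (Eq (NAdd (NApp 0 nx) (NApp 0 nx)) (NMul nx (NSuc nx)))"

lemma holds_triangle_form: "holds v w triangle_form \<longleftrightarrow> w 0 = triangle"
proof -
  have "n + n = m * Suc m \<longleftrightarrow> n = triangle m" for m n
  proof -
    have "triangle m + triangle m = m * Suc m" by (induction m) auto
    then show ?thesis by linarith
  qed
  then show ?thesis by (simp add: triangle_form_def fun_eq_iff)
qed

definition eval_form :: form where
  "eval_form =
     Conj (AllN 1 (AllN 2 (Eq (NApp2 fEv nx (NPair NZero ny)) (NApp2 fAs nx ny))))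
    (Conj (AllN 1 (AllN 2 (AllN 3 (Eq (NApp2 fEv nx (NPair (NSuc NZero) (NPair ny nz)))
             (NApp2 fF ny (NApp2 fM nx nz))))))
    (Conj (AllN 1 (Eq (NApp2 fM nx NZero) NZero))
          (AllN 1 (AllN 2 (AllN 3 (Eq (NApp2 fM nx (NSuc (NPair ny nz)))
             (NSuc (NPair (NApp2 fEv nx ny) (NApp2 fM nx nz)))))))))"

lemma holds_eval_form:
  "w 0 = triangle \<Longrightarrow> holds v w eval_form \<longleftrightarrow>
     eval_clauses (curried (w fAs)) (curried (w fEv)) (curried (w fF)) (curried (w fM))"
  by (simp add: eval_form_def eval_clauses_def nval_NPair nval_NApp2)

definition symbol_form :: form where
  "symbol_form =
     Conj (AllN 1 (AllN 2 (AllN 3 (IsBit (NApp2 fF (NSuc (NSuc (NSuc (NPair nx (NPair ny NZero))))) nz)))))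
    (Conj (Eq (NApp2 fF NZero NZero) NZero)
    (Conj (Eq (NApp2 fF (NSuc NZero) NZero) (NSuc NZero))
          (AllN 1 (AllN 2 (Imp (IsBit nx)
            (let c = NApp2 fF (NSuc (NSuc NZero)) (NSuc (NPair nx (NSuc (NPair ny NZero)))) in
             Conj (Eq (NApp2 fX c NZero) nx)
              (AllN 3 (Eq (NApp2 fX c (NSuc nz)) (NApp2 fX ny nz)))))))))"

lemma holds_symbol_form:
  "w 0 = triangle \<Longrightarrow> holds v w symbol_form \<longleftrightarrow> symbol_clauses (curried (w fX)) (curried (w fF))"
  by (simp add: symbol_form_def symbol_clauses_def nval_NPair nval_NApp2 holds_connectives Let_def
      numeral_2_eq_2)

definition assignment_form :: form where
  "assignment_form =
     Conj (AllN 1 (AllN 2 (IsBit (NApp2 fAs nx (NPair NZero ny)))))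
          (AllN 1 (AllN 2 (AllN 3 (Imp
             (AllN 4 (Imp (Eq ny (NPair NZero nu)) (IsBit nz)))
             (ExN 4 (Conj (Eq (NApp2 fAs nu ny) nz)
                (AllN 5 (Disj (Eq nt ny) (Eq (NApp2 fAs nu nt) (NApp2 fAs nx nt))))))))))"

lemma holds_assignment_form:
  "w 0 = triangle \<Longrightarrow> holds v w assignment_form \<longleftrightarrow> assignment_clauses (curried (w fAs))"
  by (simp add: assignment_form_def assignment_clauses_def nval_NPair nval_NApp2 holds_connectives)

definition countermodel_form :: form where
  "countermodel_form =
     Conj triangle_form
    (Conj (AllN 1 (AllN 2 (IsBit (NApp2 fX nx ny))))
    (Conj (AllN 1 (AllN 2 (Imp (AllN 3 (Eq (NApp2 fX nx nz) (NApp2 fX ny nz))) (Eq nx ny))))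
    (Conj assignment_form (Conj eval_form (Conj symbol_form
    (Conj (AllN 1 (AllN 2 (AllN 3 (Imp (Eq (NApp fP (NSuc (NPair (NPair nx ny) nz))) NZero)
            (Conj (Eq (NApp fP nz) NZero) (AllN 4 (Eq (NApp2 fEv nu nx) (NApp2 fEv nu ny))))))))
          (ExN 1 (ExN 2 (ExN 3 (ExN 4 (ExN 5
            (Conj (Eq (NVar 0) (NPair nx (NPair ny (NPair nz nu))))
            (Conj (Eq (NApp fP ny) NZero) (Neg (Eq (NApp2 fEv nt nz) (NApp2 fEv nt nu))))))))))))))))"

lemma holds_countermodel_form:
  "holds v w countermodel_form \<longleftrightarrow> w 0 = triangle \<and>
     countermodel (curried (w fX)) (curried (w fAs)) (curried (w fEv)) (curried (w fF))
       (curried (w fM)) (w fP) (v 0)"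
proof (cases "w 0 = triangle")
  case True
  then show ?thesis
    by (simp add: countermodel_form_def countermodel_def nval_NPair nval_NApp2 holds_connectives
        holds_triangle_form holds_assignment_form holds_eval_form holds_symbol_form)
qed (simp add: countermodel_form_def holds_triangle_form)

lemma arithmetical_countermodel_form: "arithmetical countermodel_form"
  by (simp add: countermodel_form_def triangle_form_def assignment_form_def eval_form_def
      symbol_form_def arithmetical_connectives Let_def)

definition equality_form :: form where
  "equality_form = AllF 0 (AllF fX (AllF fAs (AllF fEv (AllF fF (AllF fM (AllF fP
     (Neg countermodel_form)))))))"

text \<open>Every binary function is the curried form of a unary one, so unary function variables
  suffice. The quantifier over function variable 0 disappears because \<open>triangle_form\<close>
  leaves it a single value.\<close>

lemma holds_equality_form:
  "holds v w equality_form \<longleftrightarrow> \<not> (\<exists>X As Ev F M P. countermodel X As Ev F M P (v 0))"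
proof -
  let ?C = "\<lambda>X As Ev F M P. countermodel (curried X) (curried As) (curried Ev) (curried F) (curried M) P (v 0)"
  define unc where "unc h n = h (fst (prod_decode n)) (snd (prod_decode n))"
    for h :: "nat \<Rightarrow> nat \<Rightarrow> nat" and n
  have curried_unc: "curried (unc h) = h" for h
    by (simp add: unc_def)
  have "?C (unc X) (unc As) (unc Ev) (unc F) (unc M) P" if "countermodel X As Ev F M P (v 0)"
    for X As Ev F M P
    using that by (simp only: curried_unc)
  then have "(\<exists>X As Ev F M P. ?C X As Ev F M P) \<longleftrightarrow> (\<exists>X As Ev F M P. countermodel X As Ev F M P (v 0))"
    by blast
  moreover have "holds v w equality_form \<longleftrightarrow> \<not> (\<exists>X As Ev F M P. ?C X As Ev F M P)"
    by (simp add: equality_form_def holds_countermodel_form)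
  ultimately show ?thesis by simp
qed

lemma Pi1_form_equality_form: "Pi1_form 1 equality_form"
  unfolding equality_form_def One_nat_def
  by (intro Sigma1_form_Pi1_form.intros) (simp add: arithmetical_countermodel_form)

text \<open>Only codes of well-formed instances matter for the reduction; other numbers fall on
  whichever side the formula puts them.\<close>

definition equality_set :: "nat set" where
  "equality_set = {n. \<not> (\<exists>X As Ev F M P. countermodel X As Ev F M P n)}"

lemma equality_set_Pi1: "equality_set \<in> Pi1 1"
  using Pi1_form_equality_form
  by (auto simp: Pi1_def defines_set_def holds_equality_form equality_set_def)

instance nterm :: countable by countable_datatype
instance form :: countable by countable_datatype

section \<open>Arithmetic in bitstream specifications\<close>

text \<open>
  \<open>OAll1\<close> tests a stream for containing ones only.  \<open>OForall K x \<theta>\<close> takes the values of the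
  variables below \<open>K\<close> to the stream of the truth values of \<open>\<theta>\<close> when \<open>x\<close> is increased by \<open>0, 1, 2, \<dots>\<close>.
\<close>

datatype op = OZero | OOnes | OHead | OTail | ONot | OAnd | OIff | OAll1 | OIffs | OPlus | OMult
  | OIf | OCut | OFun nat | OForall nat nat form

instance op :: countable by countable_datatype

primrec op_args :: "op \<Rightarrow> srt list" where
  "op_args OZero = []"
| "op_args OOnes = []"
| "op_args OHead = [Stream]"
| "op_args OTail = [Stream]"
| "op_args ONot = [Bit]"
| "op_args OAnd = [Bit, Bit]"
| "op_args OIff = [Bit, Bit]"
| "op_args OAll1 = [Stream]"
| "op_args OIffs = [Stream, Stream]"
| "op_args OPlus = [Stream, Stream]"
| "op_args OMult = [Stream, Stream]"
| "op_args OIf = [Bit, Stream, Stream]"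
| "op_args OCut = [Stream]"
| "op_args (OFun g) = [Stream]"
| "op_args (OForall K x \<theta>) = replicate K Stream"

definition op_res :: "op \<Rightarrow> srt" where
  "op_res p = (if p \<in> {OHead, ONot, OAnd, OIff, OAll1} then Bit else Stream)"

definition op_sym :: "op \<Rightarrow> sym" where
  "op_sym p = Fn (to_nat p) (op_args p) (op_res p)"

abbreviation ap :: "op \<Rightarrow> trm list \<Rightarrow> trm" where
  "ap p ts \<equiv> App (op_sym p) ts"

abbreviation bit0 :: trm where "bit0 \<equiv> App Zero []"
abbreviation bit1 :: trm where "bit1 \<equiv> App One []"
abbreviation scons :: "trm \<Rightarrow> trm \<Rightarrow> trm" where "scons b t \<equiv> App SCons [b, t]"

definition base_ops :: "op list" where
  "base_ops = [OZero, OOnes, OHead, OTail, ONot, OAnd, OIff, OAll1, OIffs, OPlus, OMult, OIf, OCut]"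

text \<open>The operations are specified by recursion on the front of a stream;
  \<open>OPlus\<close>, \<open>OMult\<close> and \<open>OCut\<close> recurse along the leading ones
  of the first argument. The recursion for \<open>OAll1\<close> passes a zero at any position on to
  the result, but at the constant-one stream it only says that the value equals itself, which is why
  that case has its own equation.\<close>

definition base_eqs :: "eqn list" where
  "base_eqs = (let b = Var Bit 0; c = Var Bit 1; \<sigma> = Var Stream 0; \<tau> = Var Stream 1 in
    [(ap OZero [], scons bit0 (ap OZero [])),
     (ap OOnes [], scons bit1 (ap OOnes [])),
     (scons (ap OHead [\<sigma>]) (ap OTail [\<sigma>]), \<sigma>),
     (ap ONot [bit0], bit1),
     (ap ONot [bit1], bit0),
     (ap OAnd [bit0, b], bit0),
     (ap OAnd [bit1, b], b),
     (ap OIff [bit0, b], ap ONot [b]),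
     (ap OIff [bit1, b], b),
     (ap OAll1 [ap OOnes []], bit1),
     (ap OAll1 [scons b \<sigma>], ap OAnd [b, ap OAll1 [\<sigma>]]),
     (ap OIffs [scons b \<sigma>, scons c \<tau>], scons (ap OIff [b, c]) (ap OIffs [\<sigma>, \<tau>])),
     (ap OPlus [scons bit0 \<sigma>, \<tau>], \<tau>),
     (ap OPlus [scons bit1 \<sigma>, \<tau>], scons bit1 (ap OPlus [\<sigma>, \<tau>])),
     (ap OMult [scons bit0 \<sigma>, \<tau>], ap OZero []),
     (ap OMult [scons bit1 \<sigma>, \<tau>], ap OPlus [\<tau>, ap OMult [\<sigma>, \<tau>]]),
     (ap OIf [bit0, \<sigma>, \<tau>], \<tau>),
     (ap OIf [bit1, \<sigma>, \<tau>], \<sigma>),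
     (ap OCut [scons bit0 \<sigma>], ap OZero []),
     (ap OCut [scons bit1 \<sigma>], scons bit1 (ap OCut [\<sigma>]))])"

text \<open>Makes every stream a number: leading ones are kept, and the stream of ones becomes zero.\<close>

definition norm_trm :: "trm \<Rightarrow> trm" where
  "norm_trm t = ap OIf [ap OAll1 [t], ap OZero [], ap OCut [t]]"

text \<open>A model may interpret \<open>OFun g\<close> by any function on its streams. Normalising
  its values makes the term denote a number whatever that function is.\<close>

primrec ntrm :: "nterm \<Rightarrow> trm" where
  "ntrm (NVar x) = Var Stream x"
| "ntrm NZero = ap OZero []"
| "ntrm (NSuc a) = scons bit1 (ntrm a)"
| "ntrm (NAdd a b) = ap OPlus [ntrm a, ntrm b]"
| "ntrm (NMul a b) = ap OMult [ntrm a, ntrm b]"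
| "ntrm (NApp g a) = norm_trm (ap (OFun g) [ntrm a])"

definition all_trm :: "nat \<Rightarrow> nat \<Rightarrow> form \<Rightarrow> trm" where
  "all_trm K x \<theta> = ap OAll1
     [ap (OForall K x \<theta>) (map (\<lambda>i. if i = x then ap OZero [] else Var Stream i) [0..<K])]"

text \<open>Second-order quantifiers do not occur in the formulas to be translated.\<close>

primrec ftrm :: "nat \<Rightarrow> form \<Rightarrow> trm" where
  "ftrm K (Eq a b) = ap OAll1 [ap OIffs [ntrm a, ntrm b]]"
| "ftrm K (Neg \<theta>) = ap ONot [ftrm K \<theta>]"
| "ftrm K (Conj \<theta> \<eta>) = ap OAnd [ftrm K \<theta>, ftrm K \<eta>]"
| "ftrm K (AllN x \<theta>) = all_trm K x \<theta>"
| "ftrm K (ExN x \<theta>) = ap ONot [all_trm K x (Neg \<theta>)]"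
| "ftrm K (AllF g \<theta>) = bit0"
| "ftrm K (ExF g \<theta>) = bit0"

text \<open>A corecursion: the head is the truth value at the present arguments, the tail is the
  same stream with \<open>x\<close> increased by one. In genuine streams this fixes every position.
  The formula is part of the name of the symbol, so different subformulas do not interfere.\<close>

definition forall_eqn :: "nat \<Rightarrow> nat \<Rightarrow> form \<Rightarrow> eqn" where
  "forall_eqn K x \<theta> =
     (ap (OForall K x \<theta>) (map (Var Stream) [0..<K]),
      scons (ftrm K \<theta>) (ap (OForall K x \<theta>)
        (map (\<lambda>i. if i = x then scons bit1 (Var Stream i) else Var Stream i) [0..<K])))"

primrec feqs :: "nat \<Rightarrow> form \<Rightarrow> eqn list" where
  "feqs K (Eq a b) = []"
| "feqs K (Neg \<theta>) = feqs K \<theta>"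
| "feqs K (Conj \<theta> \<eta>) = feqs K \<theta> @ feqs K \<eta>"
| "feqs K (AllN x \<theta>) = forall_eqn K x \<theta> # feqs K \<theta>"
| "feqs K (ExN x \<theta>) = forall_eqn K x (Neg \<theta>) # feqs K \<theta>"
| "feqs K (AllF g \<theta>) = []"
| "feqs K (ExF g \<theta>) = []"

lemma has_sort_Var_iff [simp]: "has_sort \<Sigma> (Var s x) r \<longleftrightarrow> r = s"
  by (auto intro: has_sort_Var elim: has_sort.cases)

lemma has_sort_App_iff [simp]:
  "has_sort \<Sigma> (App f ts) r \<longleftrightarrow>
     f \<in> \<Sigma> \<and> r = res_sort f \<and> list_all2 (has_sort \<Sigma>) ts (arg_sorts f)"
  by (auto intro: has_sort_App elim: has_sort.cases)

lemma op_sym_sorts [simp]: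
  "arg_sorts (op_sym p) = op_args p" "res_sort (op_sym p) = op_res p"
  by (simp_all add: op_sym_def)

definition num :: "nat \<Rightarrow> nat \<Rightarrow> bool" where
  "num n = (\<lambda>k. k < n)"

lemma num_0: "num 0 = (\<lambda>_. False)"
  by (simp add: num_def)

lemma case_nat_True_num: "case_nat True (num n) = num (Suc n)"
  by (auto simp: num_def fun_eq_iff split: nat.splits)

lemma num_eq_iff [simp]: "num m = num n \<longleftrightarrow> m = n"
  by (metis linorder_neqE_nat num_def order_less_irrefl)

definition num_asg :: "(nat \<Rightarrow> nat) \<Rightarrow> srt \<Rightarrow> nat \<Rightarrow> val" where
  "num_asg v s i = (case s of Bit \<Rightarrow> VBit False | Stream \<Rightarrow> VStream (num (v i)))"

lemma num_asg_Stream [simp]: "num_asg v Stream i = VStream (num (v i))"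
  by (simp add: num_asg_def)

section \<open>What the equations force in every model\<close>

locale arith_model =
  fixes \<Sigma> D I
  assumes alg: "stream_algebra \<Sigma> D I"
    and base_sig: "\<And>p. p \<in> set base_ops \<Longrightarrow> op_sym p \<in> \<Sigma>" "{Zero, One, SCons} \<subseteq> \<Sigma>"
    and base_sat: "\<And>e. e \<in> set base_eqs \<Longrightarrow> satisfies D I e"
begin

abbreviation J :: "op \<Rightarrow> val list \<Rightarrow> val" where
  "J p \<equiv> I (op_sym p)"

lemma I_const [simp]: "I Zero [] = VBit False" "I One [] = VBit True"
  using alg by (simp_all add: stream_algebra_def)

lemma I_SCons [simp]: "\<sigma> \<in> D \<Longrightarrow> I SCons [VBit x, VStream \<sigma>] = VStream (case_nat x \<sigma>)"
  using alg by (simp add: stream_algebra_def)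

lemma J_Stream:
  assumes "op_sym p \<in> \<Sigma>" "op_res p = Stream"
    "list_all2 (\<lambda>v s. v \<in> carrier D s) vs (op_args p)"
  obtains z where "z \<in> D" "J p vs = VStream z"
proof -
  have "J p vs \<in> carrier D (res_sort (op_sym p))"
    using alg assms unfolding stream_algebra_def by (metis op_sym_sorts(1))
  then show ?thesis using that assms(2) by auto
qed

lemma J_Bit:
  assumes "op_sym p \<in> \<Sigma>" "op_res p = Bit"
    "list_all2 (\<lambda>v s. v \<in> carrier D s) vs (op_args p)"
  obtains b where "J p vs = VBit b"
proof -
  have "J p vs \<in> carrier D (res_sort (op_sym p))"
    using alg assms unfolding stream_algebra_def by (metis op_sym_sorts(1))
  then show ?thesis using that assms(2) by auto
qed

lemma case_nat_in_D: "\<sigma> \<in> D \<Longrightarrow> case_nat b \<sigma> \<in> D"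
  using stream_algebra_case_nat[OF alg] base_sig(2) by simp

lemma base_facts:
  assumes "\<sigma> \<in> D" and "\<tau> \<in> D"
  shows "J OZero [] = I SCons [VBit False, J OZero []]"
    and "J OOnes [] = I SCons [VBit True, J OOnes []]"
    and "I SCons [J OHead [VStream \<sigma>], J OTail [VStream \<sigma>]] = VStream \<sigma>"
    and "J ONot [VBit False] = VBit True"
    and "J ONot [VBit True] = VBit False"
    and "J OAnd [VBit False, VBit b] = VBit False"
    and "J OAnd [VBit True, VBit b] = VBit b"
    and "J OIff [VBit False, VBit b] = J ONot [VBit b]"
    and "J OIff [VBit True, VBit b] = VBit b"
    and "J OAll1 [J OOnes []] = VBit True"
    and "J OAll1 [VStream (case_nat b \<sigma>)] = J OAnd [VBit b, J OAll1 [VStream \<sigma>]]"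
    and "J OIffs [VStream (case_nat b \<sigma>), VStream (case_nat c \<tau>)] =
           I SCons [J OIff [VBit b, VBit c], J OIffs [VStream \<sigma>, VStream \<tau>]]"
    and "J OPlus [VStream (case_nat False \<sigma>), VStream \<tau>] = VStream \<tau>"
    and "J OPlus [VStream (case_nat True \<sigma>), VStream \<tau>] =
           I SCons [VBit True, J OPlus [VStream \<sigma>, VStream \<tau>]]"
    and "J OMult [VStream (case_nat False \<sigma>), VStream \<tau>] = J OZero []"
    and "J OMult [VStream (case_nat True \<sigma>), VStream \<tau>] =
           J OPlus [VStream \<tau>, J OMult [VStream \<sigma>, VStream \<tau>]]"
    and "J OIf [VBit False, VStream \<sigma>, VStream \<tau>] = VStream \<tau>"
    and "J OIf [VBit True, VStream \<sigma>, VStream \<tau>] = VStream \<sigma>"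
    and "J OCut [VStream (case_nat False \<sigma>)] = J OZero []"
    and "J OCut [VStream (case_nat True \<sigma>)] = I SCons [VBit True, J OCut [VStream \<sigma>]]"
proof -
  define \<alpha> where "\<alpha> s i = (case s of Bit \<Rightarrow> VBit (if i = 0 then b else c)
      | Stream \<Rightarrow> VStream (if i = 0 then \<sigma> else \<tau>))" for s and i :: nat
  have [simp]: "\<alpha> Bit 0 = VBit b" "\<alpha> Bit (Suc 0) = VBit c"
      "\<alpha> Stream 0 = VStream \<sigma>" "\<alpha> Stream (Suc 0) = VStream \<tau>"
    by (simp_all add: \<alpha>_def)
  have "\<alpha> s i \<in> carrier D s" for s i
    using assms by (cases s) (auto simp: \<alpha>_def)
  then have "assignment D \<alpha>"
    unfolding assignment_def by blast
  then have *: "\<forall>e\<in>set base_eqs. eval I \<alpha> (fst e) = eval I \<alpha> (snd e)"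
    using base_sat unfolding satisfies_def by blast
  have [simp]: "I SCons [VBit x, VStream \<sigma>] = VStream (case_nat x \<sigma>)"
      "I SCons [VBit x, VStream \<tau>] = VStream (case_nat x \<tau>)" for x
    using assms by simp_all
  note ** = *[unfolded base_eqs_def Let_def, simplified]
  show "J OZero [] = I SCons [VBit False, J OZero []]"
    "J OOnes [] = I SCons [VBit True, J OOnes []]"
    "I SCons [J OHead [VStream \<sigma>], J OTail [VStream \<sigma>]] = VStream \<sigma>"
    "J ONot [VBit False] = VBit True"
    "J ONot [VBit True] = VBit False"
    "J OAnd [VBit False, VBit b] = VBit False"
    "J OAnd [VBit True, VBit b] = VBit b"
    "J OIff [VBit False, VBit b] = J ONot [VBit b]"
    "J OIff [VBit True, VBit b] = VBit b"
    "J OAll1 [J OOnes []] = VBit True"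
    "J OAll1 [VStream (case_nat b \<sigma>)] = J OAnd [VBit b, J OAll1 [VStream \<sigma>]]"
    "J OIffs [VStream (case_nat b \<sigma>), VStream (case_nat c \<tau>)] =
           I SCons [J OIff [VBit b, VBit c], J OIffs [VStream \<sigma>, VStream \<tau>]]"
    "J OPlus [VStream (case_nat False \<sigma>), VStream \<tau>] = VStream \<tau>"
    "J OPlus [VStream (case_nat True \<sigma>), VStream \<tau>] =
           I SCons [VBit True, J OPlus [VStream \<sigma>, VStream \<tau>]]"
    "J OMult [VStream (case_nat False \<sigma>), VStream \<tau>] = J OZero []"
    "J OMult [VStream (case_nat True \<sigma>), VStream \<tau>] =
           J OPlus [VStream \<tau>, J OMult [VStream \<sigma>, VStream \<tau>]]"
    "J OIf [VBit False, VStream \<sigma>, VStream \<tau>] = VStream \<tau>"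
    "J OIf [VBit True, VStream \<sigma>, VStream \<tau>] = VStream \<sigma>"
    "J OCut [VStream (case_nat False \<sigma>)] = J OZero []"
    "J OCut [VStream (case_nat True \<sigma>)] = I SCons [VBit True, J OCut [VStream \<sigma>]]"
    by (insert **) (elim conjE, assumption)+
qed

lemma J_ONot: "J ONot [VBit b] = VBit (\<not> b)"
  and J_OAnd: "J OAnd [VBit b, VBit c] = VBit (b \<and> c)"
  and J_OIff: "J OIff [VBit b, VBit c] = VBit (b = c)"
proof -
  obtain \<sigma> where \<sigma>: "\<sigma> \<in> D" using alg by (auto simp: stream_algebra_def)
  note facts = base_facts(4-9)[OF \<sigma> \<sigma>]
  show not: "J ONot [VBit b] = VBit (\<not> b)" for b
    using facts(1,2) by (cases b) simp_all
  show "J OAnd [VBit b, VBit c] = VBit (b \<and> c)"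
    using facts(3,4) by (cases b) simp_all
  show "J OIff [VBit b, VBit c] = VBit (b = c)"
    using facts(5,6) not by (cases b) simp_all
qed

lemma J_OIf: "\<sigma> \<in> D \<Longrightarrow> \<tau> \<in> D \<Longrightarrow> J OIf [VBit b, VStream \<sigma>, VStream \<tau>] = VStream (if b then \<sigma> else \<tau>)"
  using base_facts(17,18) by simp

text \<open>Position by position, \<open>z = case_nat False z\<close> leaves the constant-zero
  stream as the only solution.\<close>

lemma J_OZero: "J OZero [] = VStream (num 0)" and num_0_in_D: "num 0 \<in> D"
proof -
  obtain z where z: "z \<in> D" "J OZero [] = VStream z"
    by (rule J_Stream[of OZero "[]"]) (simp_all add: base_sig base_ops_def op_res_def)
  then have *: "z = case_nat False z"
    using base_facts(1)[OF z(1) z(1)] by simp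
  have "\<not> z k" for k
    by (induction k) (subst *, simp)+
  then have "z = num 0" by (simp add: num_0 fun_eq_iff)
  with z show "J OZero [] = VStream (num 0)" "num 0 \<in> D" by simp_all
qed

lemma J_OOnes: "J OOnes [] = VStream (\<lambda>_. True)"
proof -
  obtain z where z: "z \<in> D" "J OOnes [] = VStream z"
    by (rule J_Stream[of OOnes "[]"]) (simp_all add: base_sig base_ops_def op_res_def)
  then have *: "z = case_nat True z"
    using base_facts(2)[OF z(1) z(1)] by simp
  have "z k" for k
    by (induction k) (subst *, simp)+
  then have "z = (\<lambda>_. True)" by (simp add: fun_eq_iff)
  with z show ?thesis by simp
qed

lemma num_in_D: "num n \<in> D"
  by (induction n) (simp_all add: num_0_in_D case_nat_in_D flip: case_nat_True_num)

text \<open>The equation for \<open>OHead\<close> and \<open>OTail\<close> closes \<open>D\<close>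
  under tails. The inductions over positions below rest on this.\<close>

lemma head_tail:
  assumes "\<sigma> \<in> D"
  obtains b z where "z \<in> D" "\<sigma> = case_nat b z" "J OHead [VStream \<sigma>] = VBit b"
proof -
  obtain b where b: "J OHead [VStream \<sigma>] = VBit b"
    by (rule J_Bit[of OHead "[VStream \<sigma>]"]) (simp_all add: base_sig base_ops_def op_res_def assms)
  obtain z where z: "z \<in> D" "J OTail [VStream \<sigma>] = VStream z"
    by (rule J_Stream[of OTail "[VStream \<sigma>]"]) (simp_all add: base_sig base_ops_def op_res_def assms)
  with that[of z b] b base_facts(3)[OF assms assms] show ?thesis by simp
qed

lemma J_OHead: "\<sigma> \<in> D \<Longrightarrow> J OHead [VStream \<sigma>] = VBit (\<sigma> 0)"
  by (erule head_tail) simp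

text \<open>A zero at position \<open>k\<close> reaches the front after \<open>k\<close> tails,
  where the conjunction becomes false; the induction never meets a stream without zeros.\<close>

lemma J_OAll1:
  assumes "\<sigma> \<in> D" shows "J OAll1 [VStream \<sigma>] = VBit (\<forall>k. \<sigma> k)"
proof (cases "\<forall>k. \<sigma> k")
  case True
  then have "\<sigma> = (\<lambda>_. True)" by (simp add: fun_eq_iff)
  then show ?thesis using base_facts(10)[OF assms assms] J_OOnes True by simp
next
  case False
  then obtain k where "\<not> \<sigma> k" by blast
  then have "J OAll1 [VStream \<sigma>] = VBit False"
    using assms
  proof (induction k arbitrary: \<sigma>)
    case 0
    obtain b z where *: "z \<in> D" "\<sigma> = case_nat b z" using head_tail[OF 0(2)] by metis
    obtain c where "J OAll1 [VStream z] = VBit c"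
      by (rule J_Bit[of OAll1 "[VStream z]"]) (simp_all add: base_sig base_ops_def op_res_def *)
    with * 0 base_facts(11)[OF *(1) *(1), of b] show ?case by (simp add: J_OAnd)
  next
    case (Suc k)
    obtain b z where *: "z \<in> D" "\<sigma> = case_nat b z" using head_tail[OF Suc(3)] by metis
    with Suc base_facts(11)[OF *(1) *(1), of b] show ?case by (simp add: J_OAnd)
  qed
  with False show ?thesis by simp
qed

lemma J_OIffs_in_D:
  assumes "\<sigma> \<in> D" "\<tau> \<in> D"
  obtains z where "z \<in> D" "J OIffs [VStream \<sigma>, VStream \<tau>] = VStream z"
  by (rule J_Stream[of OIffs "[VStream \<sigma>, VStream \<tau>]"])
    (simp_all add: base_sig base_ops_def op_res_def assms)

lemma J_OIffs:
  assumes "\<sigma> \<in> D" "\<tau> \<in> D"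
  shows "J OIffs [VStream \<sigma>, VStream \<tau>] = VStream (\<lambda>k. \<sigma> k = \<tau> k)" and "(\<lambda>k. \<sigma> k = \<tau> k) \<in> D"
proof -
  have *: "z k = (\<sigma> k = \<tau> k)"
    if "J OIffs [VStream \<sigma>, VStream \<tau>] = VStream z" "\<sigma> \<in> D" "\<tau> \<in> D" for k \<sigma> \<tau> z
    using that
  proof (induction k arbitrary: \<sigma> \<tau> z)
    case 0
    obtain b \<sigma>' where 1: "\<sigma>' \<in> D" "\<sigma> = case_nat b \<sigma>'" using head_tail[OF 0(2)] by metis
    obtain c \<tau>' where 2: "\<tau>' \<in> D" "\<tau> = case_nat c \<tau>'" using head_tail[OF 0(3)] by metis
    obtain z' where 3: "z' \<in> D" "J OIffs [VStream \<sigma>', VStream \<tau>'] = VStream z'"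
      using J_OIffs_in_D[OF 1(1) 2(1)] .
    have "z = case_nat (b = c) z'"
      using base_facts(12)[OF 1(1) 2(1), of b c] 0 1 2 3 by (simp add: J_OIff)
    then show ?case using 1 2 by simp
  next
    case (Suc k)
    obtain b \<sigma>' where 1: "\<sigma>' \<in> D" "\<sigma> = case_nat b \<sigma>'" using head_tail[OF Suc(3)] by metis
    obtain c \<tau>' where 2: "\<tau>' \<in> D" "\<tau> = case_nat c \<tau>'" using head_tail[OF Suc(4)] by metis
    obtain z' where 3: "z' \<in> D" "J OIffs [VStream \<sigma>', VStream \<tau>'] = VStream z'"
      using J_OIffs_in_D[OF 1(1) 2(1)] .
    have "z = case_nat (b = c) z'"
      using base_facts(12)[OF 1(1) 2(1), of b c] Suc.prems 1 2 3 by (simp add: J_OIff)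
    then show ?case using Suc.IH[OF 3(2) 1(1) 2(1)] 1 2 by simp
  qed
  obtain z where z: "z \<in> D" "J OIffs [VStream \<sigma>, VStream \<tau>] = VStream z"
    using J_OIffs_in_D[OF assms] .
  have "z = (\<lambda>k. \<sigma> k = \<tau> k)" using *[OF z(2) assms] by blast
  with z show "J OIffs [VStream \<sigma>, VStream \<tau>] = VStream (\<lambda>k. \<sigma> k = \<tau> k)" "(\<lambda>k. \<sigma> k = \<tau> k) \<in> D"
    by simp_all
qed

lemma J_OPlus: "J OPlus [VStream (num m), VStream (num n)] = VStream (num (m + n))"
proof (induction m)
  case 0
  have "num 0 = case_nat False (num 0)" by (auto simp: num_0 fun_eq_iff split: nat.splits)
  then show ?case using base_facts(13)[OF num_in_D num_in_D, of 0 n] by simp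
next
  case (Suc m)
  then show ?case
    using base_facts(14)[OF num_in_D num_in_D, of m n] by (simp add: case_nat_True_num num_in_D)
qed

lemma J_OMult: "J OMult [VStream (num m), VStream (num n)] = VStream (num (m * n))"
proof (induction m)
  case 0
  have "num 0 = case_nat False (num 0)" by (auto simp: num_0 fun_eq_iff split: nat.splits)
  then show ?case using base_facts(15)[OF num_in_D num_in_D, of 0 n] by (simp add: J_OZero)
next
  case (Suc m)
  then show ?case
    using base_facts(16)[OF num_in_D num_in_D, of m n] by (simp add: case_nat_True_num J_OPlus)
qed

lemma J_OCut_num: "J OCut [VStream (num m)] = VStream (num m)"
proof (induction m)
  case 0
  have "num 0 = case_nat False (num 0)" by (auto simp: num_0 fun_eq_iff split: nat.splits)
  then show ?case using base_facts(19)[OF num_in_D num_in_D, of 0] by (simp add: J_OZero)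
next
  case (Suc m)
  then show ?case
    using base_facts(20)[OF num_in_D num_in_D, of m] by (simp add: case_nat_True_num num_in_D)
qed

lemma J_OCut:
  assumes "\<sigma> \<in> D" "\<not> \<sigma> k"
  shows "\<exists>m. J OCut [VStream \<sigma>] = VStream (num m)"
  using assms
proof (induction k arbitrary: \<sigma>)
  case 0
  obtain b z where "z \<in> D" "\<sigma> = case_nat b z" using head_tail[OF 0(1)] by metis
  with 0 base_facts(19)[of z z] show ?case by (auto simp: J_OZero)
next
  case (Suc k)
  obtain b z where *: "z \<in> D" "\<sigma> = case_nat b z" using head_tail[OF Suc(2)] by metis
  show ?case
  proof (cases b)
    case True
    obtain m where "J OCut [VStream z] = VStream (num m)" using Suc * by auto
    with base_facts(20)[OF *(1) *(1)] have "J OCut [VStream \<sigma>] = VStream (num (Suc m))"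
      using * True by (simp add: case_nat_True_num num_in_D)
    then show ?thesis ..
  next
    case False
    with * base_facts(19)[OF *(1) *(1)] show ?thesis by (auto simp: J_OZero)
  qed
qed

definition norm_val :: "val \<Rightarrow> val" where
  "norm_val u = J OIf [J OAll1 [u], J OZero [], J OCut [u]]"

lemma eval_norm_trm: "eval I \<alpha> (norm_trm t) = norm_val (eval I \<alpha> t)"
  by (simp add: norm_trm_def norm_val_def)

text \<open>\<open>OCut\<close> yields a number once the stream has some zero. On the constant-one
  stream it does not, and there \<open>OIf\<close> selects zero instead.\<close>

lemma norm_val_in_num:
  assumes "\<sigma> \<in> D" shows "\<exists>m. norm_val (VStream \<sigma>) = VStream (num m)"
proof (cases "\<forall>k. \<sigma> k")
  case True
  obtain z where z: "z \<in> D" "J OCut [VStream \<sigma>] = VStream z"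
    by (rule J_Stream[of OCut "[VStream \<sigma>]"]) (simp_all add: base_sig base_ops_def op_res_def assms)
  then have "norm_val (VStream \<sigma>) = VStream (num 0)"
    using True assms by (simp add: norm_val_def J_OAll1 J_OZero J_OIf num_in_D)
  then show ?thesis ..
next
  case False
  then obtain k where "\<not> \<sigma> k" by blast
  from J_OCut[OF assms this] False assms show ?thesis
    by (auto simp: norm_val_def J_OAll1 J_OZero J_OIf num_in_D)
qed

lemma norm_val_num: "norm_val (VStream (num m)) = VStream (num m)"
proof -
  have "\<not> num m m" by (simp add: num_def)
  then have "J OAll1 [VStream (num m)] = VBit False"
    using J_OAll1[OF num_in_D, of m] by auto
  then show ?thesis
    by (simp add: norm_val_def J_OZero J_OIf num_in_D J_OCut_num)
qed

text \<open>The functions on numbers that a model carries. For a symbol of the signature such an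
  \<open>m\<close> exists, and it is unique because \<open>num\<close> is injective.\<close>

definition fun_of :: "nat \<Rightarrow> nat \<Rightarrow> nat" where
  "fun_of g n = (SOME m. norm_val (J (OFun g) [VStream (num n)]) = VStream (num m))"

lemma norm_val_OFun:
  assumes "op_sym (OFun g) \<in> \<Sigma>"
  shows "norm_val (J (OFun g) [VStream (num n)]) = VStream (num (fun_of g n))"
proof -
  obtain z where z: "z \<in> D" "J (OFun g) [VStream (num n)] = VStream z"
    by (rule J_Stream[of "OFun g" "[VStream (num n)]"]) (simp_all add: assms op_res_def num_in_D)
  with norm_val_in_num[OF z(1)] have "\<exists>m. norm_val (J (OFun g) [VStream (num n)]) = VStream (num m)"
    by simp
  then show ?thesis unfolding fun_of_def by (rule someI_ex)
qed

lemma eval_ntrm: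
  "has_sort \<Sigma> (ntrm a) Stream \<Longrightarrow> eval I (num_asg v) (ntrm a) = VStream (num (nval v fun_of a))"
proof (induction a)
  case (NApp g a)
  then have "op_sym (OFun g) \<in> \<Sigma>" "has_sort \<Sigma> (ntrm a) Stream"
    by (simp_all add: norm_trm_def)
  with NApp.IH norm_val_OFun show ?case by (simp add: eval_norm_trm)
qed (simp_all add: J_OZero J_OPlus J_OMult num_in_D case_nat_True_num)

lemma num_asg_assignment: "assignment D (num_asg v)"
  by (auto simp: assignment_def num_asg_def num_in_D split: srt.splits)

text \<open>After \<open>k\<close> unfoldings of the equation the head is the truth value with
  \<open>x\<close> increased by \<open>k\<close>, and all arguments are still numbers. The stream of
  truth values lies in \<open>D\<close> because an operation returns it; this is what makes
  \<open>OAll1\<close> applicable to it.\<close>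

lemma forall_stream:
  assumes sat: "satisfies D I (forall_eqn K x \<theta>)"
    and sig: "op_sym (OForall K x \<theta>) \<in> \<Sigma>"
    and \<theta>: "\<And>v. eval I (num_asg v) (ftrm K \<theta>) = VBit (P v)"
  shows "J (OForall K x \<theta>) (map (\<lambda>i. VStream (num (v i))) [0..<K]) =
           VStream (\<lambda>k. P (v(x := v x + k)))" (is "?U v = _")
    and "(\<lambda>k. P (v(x := v x + k))) \<in> D"
proof -
  have ex: "\<exists>z\<in>D. ?U v = VStream z" for v
    by (rule J_Stream[of "OForall K x \<theta>" "map (\<lambda>i. VStream (num (v i))) [0..<K]"])
      (auto simp: sig op_res_def num_in_D list_all2_conv_all_nth)
  have step: "?U v = I SCons [VBit (P v), ?U (v(x := Suc (v x)))]" for v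
  proof -
    have "eval I (num_asg v) (ap (OForall K x \<theta>)
        (map (\<lambda>i. if i = x then scons bit1 (Var Stream i) else Var Stream i) [0..<K])) = ?U (v(x := Suc (v x)))"
      unfolding eval.simps map_map
      by (rule arg_cong[where f = "J (OForall K x \<theta>)"]) (auto simp: num_in_D case_nat_True_num)
    moreover have "eval I (num_asg v) (ap (OForall K x \<theta>) (map (Var Stream) [0..<K])) = ?U v"
      by (simp add: comp_def)
    moreover have "eval I (num_asg v) (scons b t) = I SCons [eval I (num_asg v) b, eval I (num_asg v) t]" for b t
      by simp
    moreover have "eval I (num_asg v) (fst (forall_eqn K x \<theta>)) = eval I (num_asg v) (snd (forall_eqn K x \<theta>))"
      using sat num_asg_assignment by (simp only: satisfies_def)
    ultimately show ?thesis
      by (simp only: forall_eqn_def fst_conv snd_conv \<theta>)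
  qed
  have *: "?U v = VStream z \<Longrightarrow> z k = P (v(x := v x + k))" for k v z
  proof (induction k arbitrary: v z)
    case 0
    obtain z' where "z' \<in> D" "?U (v(x := Suc (v x))) = VStream z'" using ex by blast
    with step[of v] 0 show ?case by simp
  next
    case (Suc k)
    obtain z' where z': "z' \<in> D" "?U (v(x := Suc (v x))) = VStream z'" using ex by blast
    with step[of v] Suc.prems have "z (Suc k) = z' k" by simp
    also have "\<dots> = P ((v(x := Suc (v x)))(x := (v(x := Suc (v x))) x + k))" by (rule Suc.IH[OF z'(2)])
    also have "(v(x := Suc (v x)))(x := (v(x := Suc (v x))) x + k) = v(x := v x + Suc k)" by simp
    finally show ?case .
  qed
  obtain z where z: "z \<in> D" "?U v = VStream z" using ex by blast
  have "z = (\<lambda>k. P (v(x := v x + k)))" using *[OF z(2)] by blast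
  with z show "?U v = VStream (\<lambda>k. P (v(x := v x + k)))" "(\<lambda>k. P (v(x := v x + k))) \<in> D"
    by simp_all
qed

lemma eval_all_trm:
  assumes sat: "satisfies D I (forall_eqn K x \<theta>)"
    and sig: "op_sym (OForall K x \<theta>) \<in> \<Sigma>"
    and \<theta>: "\<And>v. eval I (num_asg v) (ftrm K \<theta>) = VBit (P v)"
  shows "eval I (num_asg v) (all_trm K x \<theta>) = VBit (\<forall>k. P (v(x := k)))"
proof -
  have "eval I (num_asg v) (ap (OForall K x \<theta>)
      (map (\<lambda>i. if i = x then ap OZero [] else Var Stream i) [0..<K]))
      = J (OForall K x \<theta>) (map (\<lambda>i. VStream (num ((v(x := 0)) i))) [0..<K])"
    unfolding eval.simps map_map
    by (rule arg_cong[where f = "J (OForall K x \<theta>)"]) (auto simp: J_OZero)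
  also have "\<dots> = VStream (\<lambda>k. P (v(x := k)))"
    using forall_stream(1)[OF sat sig \<theta>, of "v(x := 0)"] by simp
  moreover have "eval I (num_asg v) (ap OAll1 [t]) = J OAll1 [eval I (num_asg v) t]" for t
    by simp
  moreover have "J OAll1 [VStream (\<lambda>k. P (v(x := k)))] = VBit (\<forall>k. P (v(x := k)))"
    using J_OAll1[OF forall_stream(2)[OF sat sig \<theta>, of "v(x := 0)"]] by simp
  ultimately show ?thesis
    by (simp only: all_trm_def)
qed

text \<open>In the translation of a quantified formula the body occurs only inside the name of a
  symbol. Its translation occurs on the right-hand side of the quantifier equation, whose sort shows
  that the symbols of the body belong to \<open>\<Sigma>\<close>.\<close>

lemma eval_ftrm:
  assumes "arithmetical \<theta>" and "has_sort \<Sigma> (ftrm K \<theta>) Bit"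
    and "\<And>e. e \<in> set (feqs K \<theta>) \<Longrightarrow> satisfies D I e \<and> has_sort \<Sigma> (snd e) Stream"
  shows "eval I (num_asg v) (ftrm K \<theta>) = VBit (holds v fun_of \<theta>)"
  using assms
proof (induction \<theta> arbitrary: v)
  case (Eq a b)
  then show ?case
    by (simp add: eval_ntrm J_OIffs J_OAll1 num_in_D flip: fun_eq_iff)
next
  case (Neg \<theta>)
  then show ?case by (simp add: J_ONot)
next
  case (Conj \<theta> \<eta>)
  then show ?case by (simp add: J_OAnd)
next
  case (AllN x \<theta>)
  have 1: "satisfies D I (forall_eqn K x \<theta>)" "has_sort \<Sigma> (snd (forall_eqn K x \<theta>)) Stream"
    using AllN.prems(3) by simp_all
  then have 2: "op_sym (OForall K x \<theta>) \<in> \<Sigma>" "has_sort \<Sigma> (ftrm K \<theta>) Bit"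
    by (simp_all add: forall_eqn_def)
  have "eval I (num_asg v) (ftrm K \<theta>) = VBit (holds v fun_of \<theta>)" for v
    using AllN.IH[OF _ 2(2)] AllN.prems by simp
  from eval_all_trm[OF 1(1) 2(1) this] show ?case by simp
next
  case (ExN x \<theta>)
  have 1: "satisfies D I (forall_eqn K x (Neg \<theta>))" "has_sort \<Sigma> (snd (forall_eqn K x (Neg \<theta>))) Stream"
    using ExN.prems(3) by simp_all
  then have 2: "op_sym (OForall K x (Neg \<theta>)) \<in> \<Sigma>" "has_sort \<Sigma> (ftrm K \<theta>) Bit"
    by (simp_all add: forall_eqn_def)
  have "eval I (num_asg v) (ftrm K \<theta>) = VBit (holds v fun_of \<theta>)" for v
    using ExN.IH[OF _ 2(2)] ExN.prems by simp
  then have "eval I (num_asg v) (ftrm K (Neg \<theta>)) = VBit (\<not> holds v fun_of \<theta>)" for v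
    by (simp add: J_ONot)
  from eval_all_trm[OF 1(1) 2(1) this] show ?case by (simp add: J_ONot)
qed simp_all

end

section \<open>The standard model\<close>

primrec nbound :: "nterm \<Rightarrow> nat" where
  "nbound (NVar x) = Suc x"
| "nbound NZero = 0"
| "nbound (NSuc a) = nbound a"
| "nbound (NAdd a b) = max (nbound a) (nbound b)"
| "nbound (NMul a b) = max (nbound a) (nbound b)"
| "nbound (NApp g a) = nbound a"

primrec fbound :: "form \<Rightarrow> nat" where
  "fbound (Eq a b) = max (nbound a) (nbound b)"
| "fbound (Neg \<theta>) = fbound \<theta>"
| "fbound (Conj \<theta> \<eta>) = max (fbound \<theta>) (fbound \<eta>)"
| "fbound (AllN x \<theta>) = max (Suc x) (fbound \<theta>)"
| "fbound (ExN x \<theta>) = max (Suc x) (fbound \<theta>)"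
| "fbound (AllF g \<theta>) = 0"
| "fbound (ExF g \<theta>) = 0"

type_synonym stream = "nat \<Rightarrow> bool"

definition ones_then :: "nat \<Rightarrow> stream \<Rightarrow> stream" where
  "ones_then n = case_nat True ^^ n"

text \<open>On the constant-one stream this is an unspecified but fixed number, good enough as an
  argument of \<open>w g\<close>, where only the behaviour on \<open>num n\<close> matters.\<close>

definition lead :: "stream \<Rightarrow> nat" where
  "lead \<sigma> = (LEAST k. \<not> \<sigma> k)"

text \<open>For infinitely many leading ones the recursion reads \<open>z = case_nat True z\<close>,
  which forces the constant-one stream.\<close>

definition splus :: "stream \<Rightarrow> stream \<Rightarrow> stream" where
  "splus \<sigma> \<tau> = (if \<forall>k. \<sigma> k then \<sigma> else ones_then (lead \<sigma>) \<tau>)"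

text \<open>For infinitely many leading ones the recursion reads \<open>z = splus \<tau> z\<close>;
  the constant-one stream solves this for every \<open>\<tau>\<close>.\<close>

definition smult :: "stream \<Rightarrow> stream \<Rightarrow> stream" where
  "smult \<sigma> \<tau> = (if \<forall>k. \<sigma> k then \<sigma> else (splus \<tau> ^^ lead \<sigma>) (num 0))"

definition scut :: "stream \<Rightarrow> stream" where
  "scut \<sigma> = (\<lambda>k. \<forall>j\<le>k. \<sigma> j)"

primrec tsem :: "(nat \<Rightarrow> nat \<Rightarrow> nat) \<Rightarrow> nterm \<Rightarrow> (nat \<Rightarrow> stream) \<Rightarrow> stream" where
  "tsem w (NVar x) \<alpha> = \<alpha> x"
| "tsem w NZero \<alpha> = num 0"
| "tsem w (NSuc a) \<alpha> = case_nat True (tsem w a \<alpha>)"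
| "tsem w (NAdd a b) \<alpha> = splus (tsem w a \<alpha>) (tsem w b \<alpha>)"
| "tsem w (NMul a b) \<alpha> = smult (tsem w a \<alpha>) (tsem w b \<alpha>)"
| "tsem w (NApp g a) \<alpha> = num (w g (lead (tsem w a \<alpha>)))"

text \<open>A meaning of formulas under assignments of arbitrary streams, because the equations
  quantify over these. The number quantifiers still range over numbers only, as
  \<open>all_trm\<close> restarts the bound variable at zero.\<close>

primrec fsem :: "(nat \<Rightarrow> nat \<Rightarrow> nat) \<Rightarrow> form \<Rightarrow> (nat \<Rightarrow> stream) \<Rightarrow> bool" where
  "fsem w (Eq a b) \<alpha> \<longleftrightarrow> tsem w a \<alpha> = tsem w b \<alpha>"
| "fsem w (Neg \<theta>) \<alpha> \<longleftrightarrow> \<not> fsem w \<theta> \<alpha>"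
| "fsem w (Conj \<theta> \<eta>) \<alpha> \<longleftrightarrow> fsem w \<theta> \<alpha> \<and> fsem w \<eta> \<alpha>"
| "fsem w (AllN x \<theta>) \<alpha> \<longleftrightarrow> (\<forall>k. fsem w \<theta> (\<alpha>(x := num k)))"
| "fsem w (ExN x \<theta>) \<alpha> \<longleftrightarrow> (\<exists>k. fsem w \<theta> (\<alpha>(x := num k)))"
| "fsem w (AllF g \<theta>) \<alpha> \<longleftrightarrow> False"
| "fsem w (ExF g \<theta>) \<alpha> \<longleftrightarrow> False"

lemma tsem_cong:
  "nbound a \<le> K \<Longrightarrow> (\<And>i. i < K \<Longrightarrow> \<alpha> i = \<beta> i) \<Longrightarrow> tsem w a \<alpha> = tsem w a \<beta>"
  by (induction a) auto

lemma fsem_cong: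
  "fbound \<theta> \<le> K \<Longrightarrow> (\<And>i. i < K \<Longrightarrow> \<alpha> i = \<beta> i) \<Longrightarrow> fsem w \<theta> \<alpha> = fsem w \<theta> \<beta>"
proof (induction \<theta> arbitrary: \<alpha> \<beta>)
  case (Eq a b)
  then have "tsem w a \<alpha> = tsem w a \<beta>" "tsem w b \<alpha> = tsem w b \<beta>"
    by (auto intro: tsem_cong)
  then show ?case by simp
next
  case (Neg \<theta>)
  have "fsem w \<theta> \<alpha> = fsem w \<theta> \<beta>" using Neg.prems by (intro Neg.IH) auto
  then show ?case by simp
next
  case (Conj \<theta> \<eta>)
  have "fsem w \<theta> \<alpha> = fsem w \<theta> \<beta>" "fsem w \<eta> \<alpha> = fsem w \<eta> \<beta>"
    using Conj.prems by (intro Conj.IH; auto)+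
  then show ?case by simp
next
  case (AllN x \<theta>)
  have "fsem w \<theta> (\<alpha>(x := num k)) = fsem w \<theta> (\<beta>(x := num k))" for k
    using AllN.prems by (intro AllN.IH) auto
  then show ?case by simp
next
  case (ExN x \<theta>)
  have "fsem w \<theta> (\<alpha>(x := num k)) = fsem w \<theta> (\<beta>(x := num k))" for k
    using ExN.prems by (intro ExN.IH) auto
  then show ?case by simp
qed simp_all

primrec the_bit :: "val \<Rightarrow> bool" where
  "the_bit (VBit b) = b"
| "the_bit (VStream \<sigma>) = False"

primrec the_stream :: "val \<Rightarrow> stream" where
  "the_stream (VBit b) = (\<lambda>_. False)"
| "the_stream (VStream \<sigma>) = \<sigma>"

definition args_asg :: "nat \<Rightarrow> val list \<Rightarrow> nat \<Rightarrow> stream" where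
  "args_asg K vs = (\<lambda>i. if i < K then the_stream (vs ! i) else num 0)"

text \<open>For \<open>OForall\<close>, entry \<open>k\<close> puts \<open>k\<close> ones in front
  of the stream assigned to \<open>x\<close>, number or not, since its equation increases
  \<open>x\<close> by prepending a one. The values of \<open>OFun\<close> are numbers already, so
  normalisation leaves them unchanged.\<close>

primrec interp :: "(nat \<Rightarrow> nat \<Rightarrow> nat) \<Rightarrow> op \<Rightarrow> val list \<Rightarrow> val" where
  "interp w OZero vs = VStream (num 0)"
| "interp w OOnes vs = VStream (\<lambda>_. True)"
| "interp w OHead vs = VBit (the_stream (vs ! 0) 0)"
| "interp w OTail vs = VStream (\<lambda>k. the_stream (vs ! 0) (Suc k))"
| "interp w ONot vs = VBit (\<not> the_bit (vs ! 0))"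
| "interp w OAnd vs = VBit (the_bit (vs ! 0) \<and> the_bit (vs ! 1))"
| "interp w OIff vs = VBit (the_bit (vs ! 0) = the_bit (vs ! 1))"
| "interp w OAll1 vs = VBit (\<forall>k. the_stream (vs ! 0) k)"
| "interp w OIffs vs = VStream (\<lambda>k. the_stream (vs ! 0) k = the_stream (vs ! 1) k)"
| "interp w OPlus vs = VStream (splus (the_stream (vs ! 0)) (the_stream (vs ! 1)))"
| "interp w OMult vs = VStream (smult (the_stream (vs ! 0)) (the_stream (vs ! 1)))"
| "interp w OIf vs = VStream (the_stream (if the_bit (vs ! 0) then vs ! 1 else vs ! 2))"
| "interp w OCut vs = VStream (scut (the_stream (vs ! 0)))"
| "interp w (OFun g) vs = VStream (num (w g (lead (the_stream (vs ! 0)))))"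
| "interp w (OForall K x \<theta>) vs = VStream (\<lambda>k. fsem w \<theta>
     ((args_asg K vs)(x := ones_then k (args_asg K vs x))))"

text \<open>The result is coerced to the result sort because \<open>n\<close> need not fit the type of the symbol.\<close>

primrec std_interp :: "(nat \<Rightarrow> nat \<Rightarrow> nat) \<Rightarrow> sym \<Rightarrow> val list \<Rightarrow> val" where
  "std_interp w Zero vs = VBit False"
| "std_interp w One vs = VBit True"
| "std_interp w SCons vs = VStream (case_nat (the_bit (vs ! 0)) (the_stream (vs ! 1)))"
| "std_interp w (Fn n ss s) vs =
     (case s of Bit \<Rightarrow> VBit (the_bit (interp w (from_nat n) vs))
      | Stream \<Rightarrow> VStream (the_stream (interp w (from_nat n) vs)))"

lemma std_interp_op [simp]: "std_interp w (op_sym p) vs = interp w p vs"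
  by (cases p) (simp_all add: op_sym_def op_res_def)

section \<open>The standard operations satisfy the equations\<close>

lemma std_algebra: "stream_algebra \<Sigma> UNIV (std_interp w)"
proof -
  have "std_interp w f vs \<in> carrier UNIV (res_sort f)" for f vs
    by (cases f) (auto split: srt.splits)
  then show ?thesis by (simp add: stream_algebra_def)
qed

lemma ones_then_simps [simp]:
  "ones_then 0 \<sigma> = \<sigma>" "ones_then (Suc n) \<sigma> = case_nat True (ones_then n \<sigma>)"
  "ones_then n (case_nat True \<sigma>) = case_nat True (ones_then n \<sigma>)"
  "ones_then n (num 0) = num n"
proof -
  have 0: "ones_then 0 \<sigma> = \<sigma>" for \<sigma>
    by (simp add: ones_then_def)
  have Suc: "ones_then (Suc n) \<sigma> = case_nat True (ones_then n \<sigma>)" for n \<sigma>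
    by (simp add: ones_then_def)
  show "ones_then 0 \<sigma> = \<sigma>" "ones_then (Suc n) \<sigma> = case_nat True (ones_then n \<sigma>)"
    by (rule 0 Suc)+
  show "ones_then n (case_nat True \<sigma>) = case_nat True (ones_then n \<sigma>)"
    by (induction n) (simp_all only: 0 Suc)
  show "ones_then n (num 0) = num n"
    by (induction n) (simp_all only: 0 Suc case_nat_True_num)
qed

lemma all_case_nat: "(\<forall>k. case_nat b \<sigma> k) \<longleftrightarrow> b \<and> (\<forall>k. \<sigma> k)"
  by (metis nat.case not0_implies_Suc)

lemma lead_0: "lead (case_nat False \<sigma>) = 0"
  by (simp add: lead_def)

lemma lead_Suc: "\<not> (\<forall>k. \<sigma> k) \<Longrightarrow> lead (case_nat True \<sigma>) = Suc (lead \<sigma>)"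
proof -
  assume "\<not> (\<forall>k. \<sigma> k)"
  then obtain k where "\<not> case_nat True \<sigma> (Suc k)" by auto
  from Least_Suc[of "\<lambda>k. \<not> case_nat True \<sigma> k", OF this] show ?thesis
    by (simp add: lead_def)
qed

lemma lead_num [simp]: "lead (num n) = n"
  unfolding lead_def num_def by (rule Least_equality) auto

lemma splus_simps [simp]:
  "splus (case_nat False \<sigma>) \<tau> = \<tau>"
  "splus (case_nat True \<sigma>) \<tau> = case_nat True (splus \<sigma> \<tau>)"
proof -
  show "splus (case_nat False \<sigma>) \<tau> = \<tau>" by (simp add: splus_def all_case_nat lead_0)
  show "splus (case_nat True \<sigma>) \<tau> = case_nat True (splus \<sigma> \<tau>)"
    by (simp add: splus_def all_case_nat lead_Suc)
qed

lemma smult_simps [simp]: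
  "smult (case_nat False \<sigma>) \<tau> = num 0"
  "smult (case_nat True \<sigma>) \<tau> = splus \<tau> (smult \<sigma> \<tau>)"
proof -
  show "smult (case_nat False \<sigma>) \<tau> = num 0" by (simp add: smult_def all_case_nat lead_0)
  have ones: "splus \<tau> \<rho> = \<rho>" if "\<forall>k. \<rho> k" for \<rho>
  proof -
    have "\<rho> = (\<lambda>_. True)" using that by (simp add: fun_eq_iff)
    moreover have "ones_then n (\<lambda>_. True) = (\<lambda>_. True)" for n
      by (induction n) (auto simp: fun_eq_iff split: nat.splits)
    ultimately show ?thesis by (auto simp: splus_def intro!: ext)
  qed
  show "smult (case_nat True \<sigma>) \<tau> = splus \<tau> (smult \<sigma> \<tau>)"
  proof (cases "\<forall>k. \<sigma> k")
    case True
    then have "case_nat True \<sigma> = \<sigma>" by (auto simp: fun_eq_iff split: nat.splits)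
    with True ones show ?thesis by (simp add: smult_def)
  next
    case False
    then have "smult (case_nat True \<sigma>) \<tau> = (splus \<tau> ^^ Suc (lead \<sigma>)) (num 0)"
      by (simp only: smult_def all_case_nat lead_Suc simp_thms if_False)
    with False show ?thesis by (simp only: smult_def if_False funpow.simps comp_apply)
  qed
qed

lemma scut_simps [simp]:
  "scut (case_nat False \<sigma>) = num 0"
  "scut (case_nat True \<sigma>) = case_nat True (scut \<sigma>)"
  "scut (num n) = num n"
proof -
  show "scut (case_nat False \<sigma>) = num 0"
    by (auto simp: scut_def num_0 fun_eq_iff intro: exI[of _ 0])
  have "(\<forall>j\<le>Suc k. case_nat True \<sigma> j) \<longleftrightarrow> (\<forall>j\<le>k. \<sigma> j)" for k
  proof (intro iffI allI impI)
    fix j assume "\<forall>j\<le>Suc k. case_nat True \<sigma> j" "j \<le> k"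
    then have "case_nat True \<sigma> (Suc j)" by blast
    then show "\<sigma> j" by simp
  next
    fix j assume "\<forall>j\<le>k. \<sigma> j" "j \<le> Suc k"
    then show "case_nat True \<sigma> j" by (cases j) auto
  qed
  then show "scut (case_nat True \<sigma>) = case_nat True (scut \<sigma>)"
    by (auto simp: scut_def fun_eq_iff split: nat.splits)
  have "(\<forall>j\<le>k. j < n) \<longleftrightarrow> k < n" for k
    by (auto intro: le_less_trans)
  then show "scut (num n) = num n" by (simp add: scut_def num_def)
qed

lemma std_base:
  assumes "e \<in> set base_eqs"
  shows "satisfies UNIV (std_interp w) e"
  unfolding satisfies_def
proof (intro allI impI)
  fix \<alpha> assume \<alpha>: "assignment UNIV \<alpha>"
  have "\<alpha> Bit i \<in> carrier UNIV Bit" "\<alpha> Stream i \<in> carrier UNIV Stream" for i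
    using \<alpha> unfolding assignment_def by blast+
  then have "\<exists>b. \<alpha> Bit i = VBit b" "\<exists>\<sigma>. \<alpha> Stream i = VStream \<sigma>" for i
    by auto
  then obtain b c \<sigma> \<tau> where [simp]: "\<alpha> Bit 0 = VBit b" "\<alpha> Bit (Suc 0) = VBit c"
      "\<alpha> Stream 0 = VStream \<sigma>" "\<alpha> Stream (Suc 0) = VStream \<tau>"
    by metis
  have [simp]: "case_nat False (num 0) = num 0" "case_nat True (\<lambda>_. True) = (\<lambda>_. True)"
      "case_nat (\<sigma> 0) (\<lambda>k. \<sigma> (Suc k)) = \<sigma>"
      "(\<lambda>k. case_nat b \<sigma> k = case_nat c \<tau> k) = case_nat (b = c) (\<lambda>k. \<sigma> k = \<tau> k)"
    by (auto simp: num_0 fun_eq_iff split: nat.splits)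
  have "\<forall>e\<in>set base_eqs. eval (std_interp w) \<alpha> (fst e) = eval (std_interp w) \<alpha> (snd e)"
    by (simp add: base_eqs_def Let_def all_case_nat)
  with assms show "eval (std_interp w) \<alpha> (fst e) = eval (std_interp w) \<alpha> (snd e)" by blast
qed

lemma std_eval_ntrm:
  assumes "\<And>i. \<alpha> Stream i = VStream (\<beta> i)"
  shows "eval (std_interp w) \<alpha> (ntrm a) = VStream (tsem w a \<beta>)"
proof (induction a)
  case (NApp g a)
  have "\<not> num m m" for m by (simp add: num_def)
  with NApp show ?case by (auto simp: norm_trm_def)
qed (simp_all add: assms)

text \<open>Since \<open>x\<close> starts at \<open>num 0\<close>, putting \<open>k\<close> ones in
  front gives exactly \<open>num k\<close>: the tested stream runs through the numbers.\<close>

lemma std_eval_all_trm: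
  assumes "\<And>i. \<alpha> Stream i = VStream (\<beta> i)" and K: "fbound \<theta> \<le> K" "x < K"
  shows "eval (std_interp w) \<alpha> (all_trm K x \<theta>) = VBit (\<forall>k. fsem w \<theta> (\<beta>(x := num k)))"
proof -
  let ?vs = "map (\<lambda>i. VStream ((\<beta>(x := num 0)) i)) [0..<K]"
  let ?\<gamma> = "args_asg K ?vs"
  have "map (\<lambda>i. eval (std_interp w) \<alpha> (if i = x then ap OZero [] else Var Stream i)) [0..<K] = ?vs"
    using assms(1) by simp
  then have "eval (std_interp w) \<alpha> (all_trm K x \<theta>) =
      VBit (\<forall>k. fsem w \<theta> (?\<gamma>(x := ones_then k (?\<gamma> x))))"
    by (simp add: all_trm_def comp_def del: map_eq_conv)
  moreover have "fsem w \<theta> (?\<gamma>(x := ones_then k (?\<gamma> x))) = fsem w \<theta> (\<beta>(x := num k))" for k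
    by (rule fsem_cong[OF K(1)]) (use K(2) in \<open>simp add: args_asg_def\<close>)
  ultimately show ?thesis by simp
qed

lemma std_eval_ftrm:
  assumes "\<And>i. \<alpha> Stream i = VStream (\<beta> i)" and "fbound \<theta> \<le> K"
  shows "eval (std_interp w) \<alpha> (ftrm K \<theta>) = VBit (fsem w \<theta> \<beta>)"
  using assms(2)
proof (induction \<theta>)
  case (Eq a b)
  then show ?case by (simp add: std_eval_ntrm[of \<alpha> \<beta>, OF assms(1)] fun_eq_iff)
next
  case (AllN x \<theta>)
  then show ?case using std_eval_all_trm[of \<alpha> \<beta> \<theta> K x w, OF assms(1)] by simp
next
  case (ExN x \<theta>)
  then show ?case using std_eval_all_trm[of \<alpha> \<beta> "Neg \<theta>" K x w, OF assms(1)] by simp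
qed simp_all

lemma std_forall_eqn:
  assumes "fbound \<theta> \<le> K" "x < K"
  shows "satisfies UNIV (std_interp w) (forall_eqn K x \<theta>)"
  unfolding satisfies_def
proof (intro allI impI)
  fix \<alpha> assume \<alpha>: "assignment UNIV \<alpha>"
  have "\<alpha> Stream i \<in> carrier UNIV Stream" for i
    using \<alpha> unfolding assignment_def by blast
  then have "\<exists>\<sigma>. \<alpha> Stream i = VStream \<sigma>" for i
    by auto
  then obtain \<beta> where \<beta>: "\<alpha> Stream i = VStream (\<beta> i)" for i by metis
  let ?vs = "\<lambda>\<beta>. map (\<lambda>i. VStream (\<beta> i)) [0..<K]"
  let ?\<beta>' = "\<beta>(x := case_nat True (\<beta> x))"
  define U where "U \<beta> = (\<lambda>k. fsem w \<theta> (\<beta>(x := ones_then k (\<beta> x))))" for \<beta>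
  have U: "interp w (OForall K x \<theta>) (?vs \<beta>) = VStream (U \<beta>)" for \<beta>
    unfolding interp.simps U_def
    by (intro arg_cong[where f = VStream] ext fsem_cong[OF assms(1)])
      (use assms(2) in \<open>simp add: args_asg_def\<close>)
  have "map (\<lambda>i. eval (std_interp w) \<alpha> (if i = x then scons bit1 (Var Stream i) else Var Stream i)) [0..<K]
      = ?vs ?\<beta>'"
    using \<beta> by simp
  then have "eval (std_interp w) \<alpha> (ap (OForall K x \<theta>)
      (map (\<lambda>i. if i = x then scons bit1 (Var Stream i) else Var Stream i) [0..<K])) = VStream (U ?\<beta>')"
    by (simp only: eval.simps map_map comp_def std_interp_op U)
  moreover have "eval (std_interp w) \<alpha> (ap (OForall K x \<theta>) (map (Var Stream) [0..<K])) = VStream (U \<beta>)"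
    by (simp only: eval.simps map_map comp_def std_interp_op U \<beta>)
  \<comment> \<open>The tail matches because \<open>ones_then k\<close> commutes with prepending a
    one: \<open>k\<close> ones before the increased \<open>x\<close> are \<open>Suc k\<close> ones
    before \<open>x\<close>.\<close>
  moreover have "U \<beta> = case_nat (fsem w \<theta> \<beta>) (U ?\<beta>')"
    by (auto simp: U_def fun_eq_iff split: nat.splits)
  moreover have "eval (std_interp w) \<alpha> (ftrm K \<theta>) = VBit (fsem w \<theta> \<beta>)"
    by (rule std_eval_ftrm[of \<alpha> \<beta>, OF \<beta> assms(1)])
  moreover have "eval (std_interp w) \<alpha> (scons b t) =
      std_interp w SCons [eval (std_interp w) \<alpha> b, eval (std_interp w) \<alpha> t]" for b t
    by simp
  ultimately show "eval (std_interp w) \<alpha> (fst (forall_eqn K x \<theta>)) =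
      eval (std_interp w) \<alpha> (snd (forall_eqn K x \<theta>))"
    by (simp only: forall_eqn_def fst_conv snd_conv) simp
qed

lemma std_feqs:
  "fbound \<theta> \<le> K \<Longrightarrow> e \<in> set (feqs K \<theta>) \<Longrightarrow> satisfies UNIV (std_interp w) e"
  by (induction \<theta>) (auto simp: std_forall_eqn)

text \<open>Every choice \<open>w\<close> of functions comes from a model, so quantifying over
  models misses none.\<close>

lemma std_fun_of:
  assumes "arith_model \<Sigma> UNIV (std_interp w)"
  shows "arith_model.fun_of (std_interp w) = w"
proof -
  interpret arith_model \<Sigma> UNIV "std_interp w" by (rule assms)
  have "norm_val (std_interp w (op_sym (OFun g)) [VStream (num n)]) = VStream (num (w g n))" for g n
    by (simp add: norm_val_num)
  then have "fun_of g n = w g n" for g n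
    unfolding fun_of_def by simp
  then show ?thesis by blast
qed

section \<open>The reduction\<close>

primrec tsyms :: "trm \<Rightarrow> sym list" where
  "tsyms (Var s x) = []"
| "tsyms (App f ts) = f # concat (map tsyms ts)"

text \<open>Allows sorts to be checked over all symbols first, the signature being collected
  afterwards from the symbols that occur.\<close>

lemma has_sort_tsyms: "has_sort UNIV t s \<Longrightarrow> set (tsyms t) \<subseteq> \<Sigma> \<Longrightarrow> has_sort \<Sigma> t s"
proof (induction t arbitrary: s)
  case (App f ts)
  then have "has_sort \<Sigma> (ts ! i) (arg_sorts f ! i)" if "i < length ts" for i
    using that by (intro App.IH) (auto simp: list_all2_conv_all_nth UN_subset_iff)
  with App.prems show ?case
    by (simp add: list_all2_conv_all_nth)
qed simp

lemma list_all2_replicate: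
  "length xs = K \<Longrightarrow> list_all2 P xs (replicate K s) \<longleftrightarrow> (\<forall>x\<in>set xs. P x s)"
  by (auto simp: list_all2_conv_all_nth all_set_conv_all_nth)

lemma UNIV_sort_ntrm: "has_sort UNIV (ntrm a) Stream"
  by (induction a) (simp_all add: norm_trm_def op_res_def)

lemma UNIV_sort_all_trm: "has_sort UNIV (all_trm K x \<theta>) Bit"
  by (auto simp: all_trm_def op_res_def list_all2_replicate)

lemma UNIV_sort_ftrm: "has_sort UNIV (ftrm K \<theta>) Bit"
  by (induction \<theta>) (simp_all add: UNIV_sort_ntrm UNIV_sort_all_trm op_res_def)

lemma UNIV_sort_forall_eqn:
  "has_sort UNIV (fst (forall_eqn K x \<theta>)) Stream \<and> has_sort UNIV (snd (forall_eqn K x \<theta>)) Stream"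
  by (auto simp: forall_eqn_def UNIV_sort_ftrm op_res_def list_all2_replicate)

lemma UNIV_sort_feqs:
  "e \<in> set (feqs K \<theta>) \<Longrightarrow> has_sort UNIV (fst e) Stream \<and> has_sort UNIV (snd e) Stream"
  by (induction \<theta>) (use UNIV_sort_forall_eqn in auto)

lemma UNIV_sort_base_eqs:
  "e \<in> set base_eqs \<Longrightarrow> \<exists>s. has_sort UNIV (fst e) s \<and> has_sort UNIV (snd e) s"
proof -
  have "\<forall>e\<in>set base_eqs. \<exists>s. has_sort UNIV (fst e) s \<and> has_sort UNIV (snd e) s"
    by (simp add: base_eqs_def Let_def op_res_def)
  then show "e \<in> set base_eqs \<Longrightarrow> \<exists>s. has_sort UNIV (fst e) s \<and> has_sort UNIV (snd e) s"
    by blast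
qed

text \<open>The equation for the quantifier \<open>AllN 0 \<psi>\<close> provides a symbol for \<open>\<psi>\<close> that takes arguments.\<close>

definition red_K :: "form \<Rightarrow> nat" where
  "red_K \<psi> = fbound (AllN 0 \<psi>)"

definition red_eqs :: "form \<Rightarrow> eqn list" where
  "red_eqs \<psi> = base_eqs @ feqs (red_K \<psi>) (AllN 0 \<psi>)"

definition red_sig :: "form \<Rightarrow> sym list" where
  "red_sig \<psi> = [Zero, One, SCons] @ map op_sym base_ops @
     concat (map (\<lambda>(l, r). tsyms l @ tsyms r) (red_eqs \<psi>))"

primrec num_trm :: "nat \<Rightarrow> trm" where
  "num_trm 0 = ap OZero []"
| "num_trm (Suc n) = scons bit1 (num_trm n)"

text \<open>All arguments are the numeral \<open>n\<close>, matching the constant assignment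
  \<open>\<lambda>_. n\<close>, whose value at variable 0 is the candidate element. The head of the
  \<open>OForall\<close> stream is the truth value there; it is prepended to a stream because the
  terms to be compared have sort \<open>Stream\<close>.\<close>

definition red_lhs :: "form \<Rightarrow> nat \<Rightarrow> trm" where
  "red_lhs \<psi> n = scons (ap OHead [ap (OForall (red_K \<psi>) 0 \<psi>) (replicate (red_K \<psi>) (num_trm n))])
     (ap OZero [])"

definition red_rhs :: trm where
  "red_rhs = scons bit1 (ap OZero [])"

definition red_inst :: "form \<Rightarrow> nat \<Rightarrow> inst" where
  "red_inst \<psi> n = (red_sig \<psi>, red_eqs \<psi>, red_lhs \<psi> n, red_rhs)"

lemma red_sig_base:
  "p \<in> set base_ops \<Longrightarrow> op_sym p \<in> set (red_sig \<psi>)" "{Zero, One, SCons} \<subseteq> set (red_sig \<psi>)"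
  by (auto simp: red_sig_def)

lemma red_eqs_sorts:
  assumes "e \<in> set (red_eqs \<psi>)" and "has_sort UNIV (fst e) s" "has_sort UNIV (snd e) s"
  shows "has_sort (set (red_sig \<psi>)) (fst e) s" "has_sort (set (red_sig \<psi>)) (snd e) s"
proof -
  have "set (tsyms (fst e)) \<subseteq> set (red_sig \<psi>)" "set (tsyms (snd e)) \<subseteq> set (red_sig \<psi>)"
    using assms(1) by (force simp: red_sig_def case_prod_beta)+
  then show "has_sort (set (red_sig \<psi>)) (fst e) s" "has_sort (set (red_sig \<psi>)) (snd e) s"
    using assms(2,3) by (auto intro: has_sort_tsyms)
qed

lemma red_sig_OForall: "op_sym (OForall (red_K \<psi>) 0 \<psi>) \<in> set (red_sig \<psi>)"
proof -
  have "forall_eqn (red_K \<psi>) 0 \<psi> \<in> set (red_eqs \<psi>)" by (simp add: red_eqs_def)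
  from red_eqs_sorts(1)[OF this] UNIV_sort_forall_eqn show ?thesis
    by (force simp: forall_eqn_def)
qed

lemma well_formed_red_inst: "well_formed (red_inst \<psi> n)"
proof -
  let ?\<Sigma> = "set (red_sig \<psi>)"
  have "\<exists>s. has_sort ?\<Sigma> l s \<and> has_sort ?\<Sigma> r s" if "(l, r) \<in> set (red_eqs \<psi>)" for l r
  proof -
    have "\<exists>s. has_sort UNIV l s \<and> has_sort UNIV r s"
      using that UNIV_sort_base_eqs[of "(l, r)"] UNIV_sort_feqs[of "(l, r)" "red_K \<psi>" "AllN 0 \<psi>"]
      by (auto simp: red_eqs_def simp del: feqs.simps)
    with red_eqs_sorts[OF that] show ?thesis by auto
  qed
  moreover have num: "has_sort ?\<Sigma> (num_trm n) Stream"
    using red_sig_base by (induction n) (auto simp: base_ops_def op_res_def)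
  have "has_sort ?\<Sigma> (red_lhs \<psi> n) Stream"
    using red_sig_base red_sig_OForall[of \<psi>] num
    by (simp add: red_lhs_def base_ops_def op_res_def list_all2_replicate)
  moreover have "has_sort ?\<Sigma> red_rhs Stream"
    using red_sig_base(1)[of _ \<psi>] red_sig_base(2)[of \<psi>] by (simp add: red_rhs_def base_ops_def op_res_def)
  ultimately show ?thesis
    using red_sig_base(2)[of \<psi>]
    by (auto simp: red_inst_def bitstream_signature_def equational_spec_def)
qed

lemma red_eval:
  assumes model: "stream_model (set (red_sig \<psi>)) (set (red_eqs \<psi>)) D I" and \<psi>: "arithmetical \<psi>"
  shows "arith_model (set (red_sig \<psi>)) D I"
    and "satisfies D I (red_lhs \<psi> n, red_rhs) \<longleftrightarrow> holds (\<lambda>_. n) (arith_model.fun_of I) \<psi>"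
proof -
  let ?\<Sigma> = "set (red_sig \<psi>)" and ?K = "red_K \<psi>"
  have sat: "satisfies D I e" if "e \<in> set (red_eqs \<psi>)" for e
    using model that by (simp add: stream_model_def)
  show am: "arith_model ?\<Sigma> D I"
    by unfold_locales (use model red_sig_base sat in \<open>auto simp: stream_model_def red_eqs_def\<close>)
  interpret arith_model ?\<Sigma> D I by (rule am)
  have fsorts: "satisfies D I e \<and> has_sort ?\<Sigma> (snd e) Stream" if "e \<in> set (feqs ?K (AllN 0 \<psi>))" for e
    using that sat[of e] red_eqs_sorts(2)[of e \<psi>] UNIV_sort_feqs[OF that]
    by (simp add: red_eqs_def del: feqs.simps)
  have 1: "satisfies D I (forall_eqn ?K 0 \<psi>)" "has_sort ?\<Sigma> (snd (forall_eqn ?K 0 \<psi>)) Stream"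
    using fsorts[of "forall_eqn ?K 0 \<psi>"] by simp_all
  then have 2: "has_sort ?\<Sigma> (ftrm ?K \<psi>) Bit"
    by (simp add: forall_eqn_def)
  have 3: "eval I (num_asg v) (ftrm ?K \<psi>) = VBit (holds v fun_of \<psi>)" for v
    by (rule eval_ftrm[OF \<psi> 2]) (use fsorts in simp)
  let ?U = "\<lambda>k. holds ((\<lambda>_. n)(0 := n + k)) fun_of \<psi>"
  have U: "J (OForall ?K 0 \<psi>) (map (\<lambda>i. VStream (num n)) [0..<?K]) = VStream ?U" "?U \<in> D"
    using forall_stream[OF 1(1) red_sig_OForall 3, of "\<lambda>_. n"] by simp_all
  have num: "eval I \<alpha> (num_trm n) = VStream (num n)" for \<alpha>
    by (induction n) (simp_all add: J_OZero num_in_D case_nat_True_num)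
  have [simp]: "(\<lambda>_. n)(0 := n) = (\<lambda>_::nat. n)" by auto
  have "eval I \<alpha> (red_lhs \<psi> n) = VStream (case_nat (holds (\<lambda>_. n) fun_of \<psi>) (num 0))" for \<alpha>
    using U by (simp add: red_lhs_def num J_OHead J_OZero num_in_D map_replicate_const)
  moreover have "eval I \<alpha> red_rhs = VStream (case_nat True (num 0))" for \<alpha>
    by (simp add: red_rhs_def J_OZero num_in_D)
  \<comment> \<open>Both terms are closed, so any single assignment decides whether the equation is
    satisfied; one has to exist.\<close>
  moreover have "assignment D (num_asg id)" by (rule num_asg_assignment)
  ultimately show "satisfies D I (red_lhs \<psi> n, red_rhs) \<longleftrightarrow> holds (\<lambda>_. n) fun_of \<psi>"
    by (auto simp: satisfies_def case_nat_eq_iff)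
qed

text \<open>From right to left, an arbitrary model supplies its own functions \<open>fun_of\<close>,
  at which the hypothesis is used. From left to right, a given \<open>w\<close> is turned into the
  standard model.\<close>

lemma yes_red_inst:
  assumes "arithmetical \<psi>"
  shows "yes_instance (red_inst \<psi> n) \<longleftrightarrow> (\<forall>w. holds (\<lambda>_. n) w \<psi>)"
proof
  assume "\<forall>w. holds (\<lambda>_. n) w \<psi>"
  with red_eval(2)[OF _ assms] show "yes_instance (red_inst \<psi> n)"
    by (simp add: red_inst_def equal_in_all_models_def)
next
  assume yes: "yes_instance (red_inst \<psi> n)"
  show "\<forall>w. holds (\<lambda>_. n) w \<psi>"
  proof
    fix w
    have "satisfies UNIV (std_interp w) e" if "e \<in> set (red_eqs \<psi>)" for e
      using that std_base[of e w] std_feqs[of "AllN 0 \<psi>" _ e w, OF order_refl]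
      unfolding red_eqs_def red_K_def set_append by blast
    then have model: "stream_model (set (red_sig \<psi>)) (set (red_eqs \<psi>)) UNIV (std_interp w)"
      by (simp add: stream_model_def std_algebra)
    with yes have "satisfies UNIV (std_interp w) (red_lhs \<psi> n, red_rhs)"
      by (simp add: red_inst_def equal_in_all_models_def)
    with red_eval[OF model assms] show "holds (\<lambda>_. n) w \<psi>"
      by (simp add: std_fun_of)
  qed
qed

section \<open>Computability of the reduction\<close>

definition computable :: "nat \<Rightarrow> (nat list \<Rightarrow> nat) \<Rightarrow> bool" where
  "computable n f \<longleftrightarrow> partial_recursive_n n (\<lambda>xs. Some (f xs))"

lemma computable_comp:
  assumes "computable (length gs) f" and "\<And>g. g \<in> set gs \<Longrightarrow> computable n g"
  shows "computable n (\<lambda>xs. f (map (\<lambda>g. g xs) gs))"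
proof -
  let ?gs = "map (\<lambda>g xs. Some (g xs)) gs"
  have "those (map (\<lambda>g. g xs) ?gs) = Some (map (\<lambda>g. g xs) gs)" for xs :: "nat list"
    by (induction gs) simp_all
  moreover have "partial_recursive_n n
      (\<lambda>xs. Option.bind (those (map (\<lambda>g. g xs) ?gs)) (\<lambda>xs. Some (f xs)))"
    by (rule pr_comp) (use assms in \<open>auto simp: computable_def\<close>)
  ultimately show ?thesis by (simp add: computable_def)
qed

lemma computable_rec:
  assumes "computable n f" and "computable (Suc (Suc n)) g"
  shows "computable (Suc n) (\<lambda>xs. rec_nat (f (tl xs)) (\<lambda>k r. g (k # r # tl xs)) (hd xs))"
proof -
  have "rec_nat (Some a) (\<lambda>k r. Option.bind r (\<lambda>y. Some (h k y))) m = Some (rec_nat a h m)"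
    for a :: nat and h m
    by (induction m) simp_all
  with pr_rec[OF assms[unfolded computable_def]] show ?thesis
    by (simp add: computable_def)
qed

lemma computable_nth: "i < n \<Longrightarrow> computable n (\<lambda>xs. xs ! i)"
  by (simp add: computable_def pr_proj)

lemma computable_Suc: "computable n g \<Longrightarrow> computable n (\<lambda>xs. Suc (g xs))"
  using computable_comp[of "[g]" "\<lambda>xs. Suc (hd xs)" n] pr_suc by (simp add: computable_def)

lemma computable_const: "computable n (\<lambda>xs. c)"
proof (induction c)
  case 0
  show ?case by (simp add: computable_def pr_zero)
qed (rule computable_Suc)

lemma computable_add:
  assumes "computable n g" "computable n h"
  shows "computable n (\<lambda>xs. g xs + h xs)"
proof -
  have "computable (Suc 1) (\<lambda>xs. rec_nat (tl xs ! 0) (\<lambda>k r. Suc ((k # r # tl xs) ! 1)) (hd xs))"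
    by (intro computable_rec computable_Suc computable_nth) simp_all
  moreover have "rec_nat b (\<lambda>k r. Suc r) a = a + b" for a b by (induction a) simp_all
  ultimately have "computable 2 (\<lambda>xs. hd xs + tl xs ! 0)" by (simp add: numeral_2_eq_2)
  with computable_comp[of "[g, h]" "\<lambda>xs. hd xs + tl xs ! 0" n] assms show ?thesis
    by (auto simp: numeral_2_eq_2)
qed

lemma computable_triangle:
  assumes "computable n g"
  shows "computable n (\<lambda>xs. triangle (g xs))"
proof -
  have "computable (Suc 0) (\<lambda>xs. rec_nat 0
      (\<lambda>k r. (k # r # tl xs) ! 1 + Suc ((k # r # tl xs) ! 0)) (hd xs))"
    by (rule computable_rec) (intro computable_add computable_Suc computable_nth computable_const; simp)+
  moreover have "rec_nat 0 (\<lambda>k r. Suc (r + k)) m = triangle m" for m by (induction m) simp_all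
  ultimately have "computable 1 (\<lambda>xs. triangle (hd xs))" by simp
  with computable_comp[of "[g]" "\<lambda>xs. triangle (hd xs)" n] assms show ?thesis
    by simp
qed

lemma computable_prod_encode:
  "computable n g \<Longrightarrow> computable n h \<Longrightarrow> computable n (\<lambda>xs. prod_encode (g xs, h xs))"
  by (simp add: prod_encode_def computable_add computable_triangle)

lemma computable_code_num_trm: "computable 1 (\<lambda>xs. code_trm (num_trm (hd xs)))"
proof -
  \<comment> \<open>The code of \<open>scons bit1 t\<close> from the code \<open>y\<close> of
    \<open>t\<close>: 1 tags an application, 2 is the code of \<open>SCons\<close>, and the rest
    codes the list of its two arguments.\<close>
  let ?c = "\<lambda>y. prod_encode (1, prod_encode (2, Suc (prod_encode (code_trm bit1, Suc (prod_encode (y, 0))))))"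
  have "computable (Suc 0) (\<lambda>xs. rec_nat (code_trm (ap OZero [])) (\<lambda>k r. ?c ((k # r # tl xs) ! 1)) (hd xs))"
    by (intro computable_rec computable_prod_encode computable_Suc computable_const computable_nth) simp
  moreover have "rec_nat (code_trm (ap OZero [])) (\<lambda>k. ?c) n = code_trm (num_trm n)" for n
    by (induction n) simp_all
  ultimately show ?thesis by simp
qed

lemma computable_replicate:
  "computable n g \<Longrightarrow> computable n (\<lambda>xs. list_encode (replicate K (g xs)))"
  by (induction K) (simp_all add: computable_const computable_Suc computable_prod_encode)

text \<open>The number \<open>n\<close> enters only through the numerals in \<open>red_lhs\<close>;
  signature and equations depend on \<open>\<psi>\<close> alone and contribute constants.\<close>

lemma partial_recursive_red: "partial_recursive (\<lambda>n. Some (code_inst (red_inst \<psi> n)))"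
proof -
  have "computable 1 (\<lambda>xs. code_inst (red_inst \<psi> (hd xs)))"
    unfolding red_inst_def red_lhs_def code_inst.simps code_trm.simps list.map map_replicate list_encode.simps
    by (intro computable_prod_encode computable_const computable_Suc computable_replicate
        computable_code_num_trm)
  then show ?thesis
    unfolding computable_def partial_recursive_def by force
qed

section \<open>Completeness\<close>

text \<open>With all function variables quantified universally from outside, a leading
  \<open>AllF g\<close> changes nothing, so the whole prefix can be stripped.\<close>

lemma Pi1_1_matrix:
  assumes "Pi1_form 1 \<phi>"
  obtains \<psi> where "arithmetical \<psi>" "\<And>v. (\<forall>w. holds v w \<phi>) \<longleftrightarrow> (\<forall>w. holds v w \<psi>)"
proof -
  have "\<exists>\<psi>. arithmetical \<psi> \<and> (\<forall>v. (\<forall>w. holds v w \<phi>) \<longleftrightarrow> (\<forall>w. holds v w \<psi>))"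
    if "Pi1_form n \<phi>" "n = 1" for n
    using that
  \<comment> \<open>The simultaneous induction needs a claim about \<open>Sigma1_form\<close>; only
    level 0 matters, where such formulas are arithmetical.\<close>
  proof (induction rule: Sigma1_form_Pi1_form.inducts(2)[where ?P1.0 = "\<lambda>n \<phi>. n = 0 \<longrightarrow> arithmetical \<phi>"])
    case (Pi1_All n \<phi> g)
    then obtain \<psi> where \<psi>: "arithmetical \<psi>" "\<And>v. (\<forall>w. holds v w \<phi>) \<longleftrightarrow> (\<forall>w. holds v w \<psi>)"
      by auto
    have "(\<forall>w. holds v w (AllF g \<phi>)) \<longleftrightarrow> (\<forall>w. holds v w \<phi>)" for v
      by (metis fun_upd_triv holds.simps(6))
    with \<psi> show ?case by auto
  qed auto
  with assms that show ?thesis by blast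
qed

lemma equality_problem_hard: "hard_for (Pi1 1) equality_problem"
  unfolding hard_for_def
proof
  fix A assume "A \<in> Pi1 1"
  then obtain \<phi> where \<phi>: "Pi1_form 1 \<phi>" "\<And>v w. holds v w \<phi> \<longleftrightarrow> v 0 \<in> A"
    by (auto simp: Pi1_def defines_set_def)
  obtain \<psi> where \<psi>: "arithmetical \<psi>" "\<And>v. (\<forall>w. holds v w \<phi>) \<longleftrightarrow> (\<forall>w. holds v w \<psi>)"
    using Pi1_1_matrix[OF \<phi>(1)] by blast
  \<comment> \<open>Whether \<open>\<phi>\<close> holds does not depend on \<open>w\<close>, so
    quantifying over \<open>w\<close> is harmless for \<open>\<phi>\<close> and gives access to
    \<open>\<psi>\<close>.\<close>
  have "n \<in> A \<longleftrightarrow> (\<forall>w. holds (\<lambda>_. n) w \<psi>)" for n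
    using \<psi>(2)[of "\<lambda>_. n"] \<phi>(2)[of "\<lambda>_. n"] by simp
  then have "n \<in> A \<longleftrightarrow> code_inst (red_inst \<psi> n) \<in> snd equality_problem" for n
    using yes_red_inst[OF \<psi>(1)] well_formed_red_inst inj_code_inst
    by (auto simp: equality_problem_def inj_image_mem_iff simp del: well_formed.simps yes_instance.simps)
  moreover have "code_inst (red_inst \<psi> n) \<in> fst equality_problem" for n
    using well_formed_red_inst by (simp add: equality_problem_def)
  ultimately show "many_one_reducible (UNIV, A) equality_problem"
    unfolding many_one_reducible_def using partial_recursive_red[of \<psi>] by auto
qed

lemma equality_set_correct:
  assumes "well_formed i"
  shows "code_inst i \<in> equality_set \<longleftrightarrow> yes_instance i"
proof -
  obtain \<Sigma> E s t where i: "i = (\<Sigma>, E, s, t)" by (cases i)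
  show ?thesis
    using countermodel_imp_no[of _ _ _ _ _ _ \<Sigma> E s t] no_imp_countermodel[of \<Sigma> E s t] assms
    unfolding i equality_set_def by blast
qed

lemma partial_recursive_id: "partial_recursive Some"
  using pr_proj[of 0 1] unfolding partial_recursive_def by force

lemma equality_problem_reducible: "many_one_reducible equality_problem (UNIV, equality_set)"
proof -
  have "code_inst i \<in> snd equality_problem \<longleftrightarrow> code_inst i \<in> equality_set" if "well_formed i" for i
    using that equality_set_correct[OF that] inj_image_mem_iff[OF inj_code_inst]
    by (simp add: equality_problem_def)
  then show ?thesis
    unfolding many_one_reducible_def using partial_recursive_id
    by (intro exI[of _ Some]) (auto simp: equality_problem_def simp del: well_formed.simps yes_instance.simps)
qed

theorem theorem1: "complete_for (Pi1 1) equality_problem"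
  unfolding complete_for_def
  using equality_problem_hard equality_set_Pi1 equality_problem_reducible by blast

end
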